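(* Let $p(y_1,y_2|x_1,x_2)$ be a discrete memoryless interference channel with capacity region $\mathcal{C}$, and let $(U_1,V_1)\sim p(u_1,v_1)$ and $(U_2,V_2)\sim p(u_2,v_2)$ be two mutually independent source/side-information pairs on finite alphabets, where side information $V_k^n$ is available at Receiver $k$, $k=1,2$ (each receiver has side information correlated with its own desired source). Sources $U_1$ and $U_2$ can be transmitted reliably to their respective receivers over this channel if $$(H(U_1|V_1),\,H(U_2|V_2))\in \mathrm{int}(\mathcal{C}),$$ where $\mathrm{int}(\cdot)$ denotes the interior. Conversely, if $(H(U_1|V_1),H(U_2|V_2))\notin\mathcal{C}$, then sources $U_1$ and $U_2$ cannot be transmitted reliably.
   Context: Channel: a discrete memoryless interference channel has finite input alphabets $\mathcal{X}_1,\mathcal{X}_2$, finite output alphabets $\mathcal{Y}_1,\mathcal{Y}_2$, and transition probability $p(y_1,y_2|x_1,x_2)$; $n$ uses of the channel are governed by the product law $\prod_{i=1}^n p(y_{1,i},y_{2,i}|x_{1,i},x_{2,i})$. Logarithms are base 2. Notation: $A^n=(A_1,\dots,A_n)$. Sources: $(U_{1,i},V_{1,i},U_{2,i},V_{2,i})_{i\ge1}$ are i.i.d. with law $p(u_1,v_1)p(u_2,v_2)$ on the finite alphabet $\mathcal{U}_1\times\mathcal{V}_1\times\mathcal{U}_2\times\mathcal{V}_2$. Source-channel code: Transmitter $k$ observes $U_k^n$ and sends $X_k^n=f_k^n(U_k^n)$, where $f_k^n:\mathcal{U}_k^n\to\mathcal{X}_k^n$. Receiver $k$ observes $Y_k^n$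 and $V_k^n$ and outputs $\hat U_k^n=g_k^n(Y_k^n,V_k^n)$, where $g_k^n:\mathcal{Y}_k^n\times\mathcal{V}_k^n\to\mathcal{U}_k^n$. The error probability is $P_e^n=\Pr\{(U_1^n,U_2^n)\ne(\hat U_1^n,\hat U_2^n)\}$. The sources can be transmitted reliably if there is a sequence of encoders and decoders $(f_1^n,f_2^n,g_1^n,g_2^n)$ with $P_e^n\to0$ as $n\to\infty$. Capacity region $\mathcal{C}$: the closure of the set of rate pairs $(R_1,R_2)$, $R_k\ge0$, for which there is a sequence of (classical) length-$n$ interference channel codes in which Transmitter $k$ maps a message $W_k$, uniform on $\{1,\dots,2^{nR_k}\}$ ($W_1,W_2$ independent), to $X_k^n\in\mathcal{X}_k^n$, Receiver $k$ estimates $W_k$ from $Y_k^n$ alone, and the probability that at least one receiver errs tends to $0$ as $n\to\infty$. *)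

theory Defs
  imports "HOL-Probability.Information" "HOL-Probability.Product_PMF" "HOL-Library.Monad_Syntax"
begin

text \<open>
  All alphabets are finite types.  A word of length \<open>n\<close> is an extensional function on
  \<open>{..<n}\<close>, i.e. a function with the value \<open>undefined\<close> at every index \<open>i \<ge> n\<close>, so that
  equality of words is equality of functions.
\<close>

definition words :: "nat \<Rightarrow> (nat \<Rightarrow> 'a) set" where
  "words n = {..<n} \<rightarrow>\<^sub>E UNIV"

text \<open>
  Componentwise image of a word.  The restriction is needed because \<open>f undefined\<close> need not be
  \<open>undefined\<close>.
\<close>

definition word_map :: "nat \<Rightarrow> ('a \<Rightarrow> 'b) \<Rightarrow> (nat \<Rightarrow> 'a) \<Rightarrow> (nat \<Rightarrow> 'b)" where
  "word_map n f w = (\<lambda>i\<in>{..<n}. f (w i))"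

text \<open>An interference channel \<open>p(y\<^sub>1, y\<^sub>2 | x\<^sub>1, x\<^sub>2)\<close>.\<close>

type_synonym ('x1, 'x2, 'y1, 'y2) interference_channel = "'x1 \<Rightarrow> 'x2 \<Rightarrow> ('y1 \<times> 'y2) pmf"

definition memoryless_uses ::
  "('x1, 'x2, 'y1, 'y2) interference_channel \<Rightarrow> nat \<Rightarrow> (nat \<Rightarrow> 'x1) \<Rightarrow> (nat \<Rightarrow> 'x2)
     \<Rightarrow> (nat \<Rightarrow> 'y1 \<times> 'y2) pmf" where
  "memoryless_uses W n x1 x2 = Pi_pmf {..<n} undefined (\<lambda>i. W (x1 i) (x2 i))"


subsection \<open>Channel codes and the capacity region\<close>

text \<open>The message set \<open>{1, \<dots>, 2\<^sup>n\<^sup>R}\<close>; for non-integral \<open>2\<^sup>n\<^sup>R\<close> it ends at the integer part.\<close>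

definition messages :: "nat \<Rightarrow> real \<Rightarrow> nat set" where
  "messages n R = {m. 1 \<le> m \<and> real m \<le> 2 powr (real n * R)}"

definition channel_code ::
  "nat \<Rightarrow> real \<Rightarrow> real \<Rightarrow>
   (nat \<Rightarrow> nat \<Rightarrow> 'x1) \<Rightarrow> (nat \<Rightarrow> nat \<Rightarrow> 'x2) \<Rightarrow>
   ((nat \<Rightarrow> 'y1) \<Rightarrow> nat) \<Rightarrow> ((nat \<Rightarrow> 'y2) \<Rightarrow> nat) \<Rightarrow> bool" where
  "channel_code n R1 R2 e1 e2 d1 d2 \<longleftrightarrow>
     e1 \<in> messages n R1 \<rightarrow> words n \<and> e2 \<in> messages n R2 \<rightarrow> words n \<and>
     d1 \<in> words n \<rightarrow> messages n R1 \<and> d2 \<in> words n \<rightarrow> messages n R2"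

definition channel_code_error ::
  "('x1, 'x2, 'y1, 'y2) interference_channel \<Rightarrow> nat \<Rightarrow> real \<Rightarrow> real \<Rightarrow>
   (nat \<Rightarrow> nat \<Rightarrow> 'x1) \<Rightarrow> (nat \<Rightarrow> nat \<Rightarrow> 'x2) \<Rightarrow>
   ((nat \<Rightarrow> 'y1) \<Rightarrow> nat) \<Rightarrow> ((nat \<Rightarrow> 'y2) \<Rightarrow> nat) \<Rightarrow> real" where
  "channel_code_error W n R1 R2 e1 e2 d1 d2 =
     pmf (do {
       w1 \<leftarrow> pmf_of_set (messages n R1);
       w2 \<leftarrow> pmf_of_set (messages n R2);
       y \<leftarrow> memoryless_uses W n (e1 w1) (e2 w2);
       return_pmf (d1 (word_map n fst y) \<noteq> w1 \<or> d2 (word_map n snd y) \<noteq> w2)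
     }) True"

definition achievable ::
  "('x1, 'x2, 'y1, 'y2) interference_channel \<Rightarrow> real \<times> real \<Rightarrow> bool" where
  "achievable W = (\<lambda>(R1, R2). 0 \<le> R1 \<and> 0 \<le> R2 \<and>
     (\<exists>e1 e2 d1 d2.
        (\<forall>n. channel_code n R1 R2 (e1 n) (e2 n) (d1 n) (d2 n)) \<and>
        (\<lambda>n. channel_code_error W n R1 R2 (e1 n) (e2 n) (d1 n) (d2 n)) \<longlonglongrightarrow> 0))"

definition capacity_region ::
  "('x1, 'x2, 'y1, 'y2) interference_channel \<Rightarrow> (real \<times> real) set" where
  "capacity_region W = closure {R. achievable W R}"


subsection \<open>Source-channel codes\<close>

definition source_channel_code ::
  "nat \<Rightarrow>
   ((nat \<Rightarrow> 'u1) \<Rightarrow> nat \<Rightarrow> 'x1) \<Rightarrow> ((nat \<Rightarrow> 'u2) \<Rightarrow> nat \<Rightarrow> 'x2) \<Rightarrow>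
   ((nat \<Rightarrow> 'y1) \<Rightarrow> (nat \<Rightarrow> 'v1) \<Rightarrow> nat \<Rightarrow> 'u1) \<Rightarrow>
   ((nat \<Rightarrow> 'y2) \<Rightarrow> (nat \<Rightarrow> 'v2) \<Rightarrow> nat \<Rightarrow> 'u2) \<Rightarrow> bool" where
  "source_channel_code n f1 f2 g1 g2 \<longleftrightarrow>
     f1 \<in> words n \<rightarrow> words n \<and> f2 \<in> words n \<rightarrow> words n \<and>
     g1 \<in> words n \<rightarrow> words n \<rightarrow> words n \<and> g2 \<in> words n \<rightarrow> words n \<rightarrow> words n"

text \<open>
  \<open>P1\<close> and \<open>P2\<close> are the laws of \<open>(U\<^sub>1, V\<^sub>1)\<close> and \<open>(U\<^sub>2, V\<^sub>2)\<close>; the word \<open>s\<close> consists of \<open>n\<close>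
  i.i.d. samples \<open>((U\<^sub>1, V\<^sub>1), (U\<^sub>2, V\<^sub>2))\<close>.
\<close>

definition source_channel_error ::
  "('x1, 'x2, 'y1, 'y2) interference_channel \<Rightarrow>
   ('u1 \<times> 'v1) pmf \<Rightarrow> ('u2 \<times> 'v2) pmf \<Rightarrow> nat \<Rightarrow>
   ((nat \<Rightarrow> 'u1) \<Rightarrow> nat \<Rightarrow> 'x1) \<Rightarrow> ((nat \<Rightarrow> 'u2) \<Rightarrow> nat \<Rightarrow> 'x2) \<Rightarrow>
   ((nat \<Rightarrow> 'y1) \<Rightarrow> (nat \<Rightarrow> 'v1) \<Rightarrow> nat \<Rightarrow> 'u1) \<Rightarrow>
   ((nat \<Rightarrow> 'y2) \<Rightarrow> (nat \<Rightarrow> 'v2) \<Rightarrow> nat \<Rightarrow> 'u2) \<Rightarrow> real" where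
  "source_channel_error W P1 P2 n f1 f2 g1 g2 =
     pmf (do {
       s \<leftarrow> Pi_pmf {..<n} undefined (\<lambda>_. pair_pmf P1 P2);
       let u1 = word_map n (\<lambda>((u1, v1), (u2, v2)). u1) s;
       let v1 = word_map n (\<lambda>((u1, v1), (u2, v2)). v1) s;
       let u2 = word_map n (\<lambda>((u1, v1), (u2, v2)). u2) s;
       let v2 = word_map n (\<lambda>((u1, v1), (u2, v2)). v2) s;
       y \<leftarrow> memoryless_uses W n (f1 u1) (f2 u2);
       return_pmf ((u1, u2) \<noteq> (g1 (word_map n fst y) v1, g2 (word_map n snd y) v2))
     }) True"

definition reliably_transmittable ::
  "('x1, 'x2, 'y1, 'y2) interference_channel \<Rightarrow>
   ('u1 \<times> 'v1) pmf \<Rightarrow> ('u2 \<times> 'v2) pmf \<Rightarrow> bool" where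
  "reliably_transmittable W P1 P2 \<longleftrightarrow>
     (\<exists>f1 f2 g1 g2.
        (\<forall>n. source_channel_code n (f1 n) (f2 n) (g1 n) (g2 n)) \<and>
        (\<lambda>n. source_channel_error W P1 P2 n (f1 n) (f2 n) (g1 n) (g2 n)) \<longlonglongrightarrow> 0)"


subsection \<open>Conditional entropy\<close>

text \<open>\<open>H(U | V)\<close> in bits for \<open>(U, V)\<close> with law \<open>P\<close>.\<close>

definition cond_entropy :: "('u \<times> 'v) pmf \<Rightarrow> real" where
  "cond_entropy P =
     prob_space.conditional_entropy (measure_pmf P) 2 (count_space UNIV) (count_space UNIV) fst snd"

lemma cond_entropy_eq:
  fixes P :: "('u::finite \<times> 'v::finite) pmf"
  shows "cond_entropy P =
    - (\<Sum>(u, v)\<in>UNIV. pmf P (u, v) * log 2 (pmf P (u, v) / pmf (map_pmf snd P) v))"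
proof -
  interpret information_space "measure_pmf P" 2
    by standard simp
  have Y: "simple_distributed (measure_pmf P) snd (pmf (map_pmf snd P))"
    by (rule measure_pmf.simple_distributedI)
       (auto simp: simple_function_def pmf_map vimage_def measure_pmf.emeasure_eq_measure)
  have XY: "simple_distributed (measure_pmf P) (\<lambda>x. (fst x, snd x)) (pmf P)"
    by (rule measure_pmf.simple_distributedI)
       (auto simp: simple_function_def pmf.rep_eq vimage_def measure_pmf.emeasure_eq_measure
             intro!: arg_cong[where f = "measure (measure_pmf P)"])
  show ?thesis
    using conditional_entropy_eq[OF Y XY] by (simp add: cond_entropy_def)
qed

end

theory Submission
  imports Defs "HOL-Probability.Hoeffding" "HOL-Real_Asymp.Real_Asymp"
begin

text \<open>
  Both directions turn one kind of code into the other by a random choice, so that neither mutual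
  information nor Fano's inequality is needed.

  Direct part: bin the source words of each user at random into the messages of a channel code with
  rates \<open>R\<^sub>k > H(U\<^sub>k | V\<^sub>k)\<close>.  For fixed source words the pair of bin numbers is then uniform, so
  the expected channel error is exactly the average error of the channel code.  Receiver \<open>k\<close> picks
  from the decoded bin a word \<open>u\<close> with \<open>p(u | v) \<ge> 2\<^sup>-\<^sup>n\<^sup>(\<^sup>H\<^sup>+\<^sup>\<epsilon>\<^sup>)\<close>; there are at most \<open>2\<^sup>n\<^sup>(\<^sup>H\<^sup>+\<^sup>\<epsilon>\<^sup>)\<close> of
  these, so ambiguity is unlikely.

  Converse: fix side-information words \<open>v\<^sub>1, v\<^sub>2\<close>, known to everybody, and draw a codebook of source
  words from \<open>p(\<cdot> | v\<^sub>k)\<close>.  For a fixed message the codeword has exactly the law of the source given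
  \<open>v\<^sub>k\<close>, so sending it through the source-channel code reproduces the error of that code, and two
  codewords rarely coincide as long as the rate is below \<open>H(U\<^sub>k | V\<^sub>k)\<close>.
\<close>

subsection \<open>Probabilities of events\<close>

text \<open>Evaluation at \<open>True\<close> copies the shape of both error probabilities in the
  definitions, so these become \<open>pr\<close> by the monad laws alone.\<close>

definition pr :: "'a pmf \<Rightarrow> ('a \<Rightarrow> bool) \<Rightarrow> real" where
  "pr p A = pmf (map_pmf A p) True"

lemma pr_eq_prob: "pr p A = measure_pmf.prob p {x. A x}"
  by (simp add: pr_def pmf_map vimage_def)

lemma pr_nonneg: "0 \<le> pr p A" and pr_le_1: "pr p A \<le> 1"
  by (simp_all add: pr_def pmf_le_1)

lemma pr_map: "pr (map_pmf f p) A = pr p (\<lambda>x. A (f x))"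
  by (simp add: pr_def pmf.map_comp o_def)

lemma pr_bind: "pr (bind_pmf p f) A = measure_pmf.expectation p (\<lambda>x. pr (f x) A)"
  by (simp add: pr_def map_bind_pmf pmf_bind)

lemma pr_mono:
  assumes "\<And>x. x \<in> set_pmf p \<Longrightarrow> A x \<Longrightarrow> B x"
  shows "pr p A \<le> pr p B"
  unfolding pr_eq_prob
  by (rule measure_pmf.finite_measure_mono_AE) (use assms in \<open>auto simp: AE_measure_pmf_iff\<close>)

lemma pr_disj_le: "pr p (\<lambda>x. A x \<or> B x) \<le> pr p A + pr p B"
  unfolding pr_eq_prob Collect_disj_eq by (intro measure_Un_le) auto

lemma pr_Bex_le:
  assumes "finite I"
  shows "pr p (\<lambda>x. \<exists>i\<in>I. A i x) \<le> (\<Sum>i\<in>I. pr p (A i))"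
proof -
  have "{x. \<exists>i\<in>I. A i x} = (\<Union>i\<in>I. {x. A i x})" by auto
  then show ?thesis
    unfolding pr_eq_prob by (simp add: assms measure_pmf.finite_measure_subadditive_finite)
qed

lemma integrable_pr: "integrable (measure_pmf p) (\<lambda>x. pr (f x) A)"
  by (rule measure_pmf.integrable_const_bound[where B = 1]) (auto simp: pr_nonneg pr_le_1)

lemma pr_bind_le:
  assumes "\<And>x. x \<in> set_pmf p \<Longrightarrow> pr (f x) A \<le> c"
  shows "pr (bind_pmf p f) A \<le> c"
proof -
  have "pr (bind_pmf p f) A \<le> measure_pmf.expectation p (\<lambda>_. c)"
    unfolding pr_bind
    by (intro integral_mono_AE integrable_pr) (use assms in \<open>auto simp: AE_measure_pmf_iff\<close>)
  then show ?thesis by simp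
qed

text \<open>Derandomisation: if every outcome in the support were strictly worse than the mean, the
  mean would exceed itself.\<close>

lemma ex_pr_le_pr_bind: "\<exists>x\<in>set_pmf p. pr (f x) A \<le> pr (bind_pmf p f) A"
proof (rule ccontr)
  assume "\<not> ?thesis"
  then have less: "\<And>x. x \<in> set_pmf p \<Longrightarrow> pr (bind_pmf p f) A < pr (f x) A" by force
  have "measure_pmf.expectation p (\<lambda>_. pr (bind_pmf p f) A) < measure_pmf.expectation p (\<lambda>x. pr (f x) A)"
    by (intro measure_pmf.integral_less_AE_space integrable_pr)
       (use less in \<open>auto simp: AE_measure_pmf_iff\<close>)
  then show False by (simp add: pr_bind)
qed

subsection \<open>Random binning and random codebooks\<close>

text \<open>The values of \<open>f\<close> are independent, so \<open>f y\<close> can be drawn last.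
  With \<open>f x\<close> already fixed, hitting it has probability \<open>pmf p (f x)\<close>,
  which is at most \<open>c\<close> under \<open>T (f x)\<close>; otherwise the event is
  empty.\<close>

lemma pr_Pi_pmf_collision_le:
  assumes "finite A" "x \<in> A" "y \<in> A" "x \<noteq> y" "\<And>a. T a \<Longrightarrow> pmf p a \<le> c" "0 \<le> c"
  shows "pr (Pi_pmf A d (\<lambda>_. p)) (\<lambda>f. f y = f x \<and> T (f x)) \<le> c"
proof -
  have A: "A = insert y (A - {y})" using assms by auto
  have "Pi_pmf A d (\<lambda>_. p) = do {f \<leftarrow> Pi_pmf (A - {y}) d (\<lambda>_. p); a \<leftarrow> p; return_pmf (f(y := a))}"
    by (subst A, subst Pi_pmf_insert') (use assms in \<open>auto intro: bind_commute_pmf\<close>)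
  moreover have "pr (do {a \<leftarrow> p; return_pmf (f(y := a))}) (\<lambda>f. f y = f x \<and> T (f x)) \<le> c" for f
  proof -
    have "pr (do {a \<leftarrow> p; return_pmf (f(y := a))}) (\<lambda>f. f y = f x \<and> T (f x))
        = pr p (\<lambda>a. a = f x \<and> T (f x))"
      using assms by (simp add: map_pmf_def[symmetric] pr_map)
    also have "\<dots> \<le> c"
      using assms by (cases "T (f x)") (auto simp: pr_eq_prob measure_pmf_single)
    finally show ?thesis .
  qed
  ultimately show ?thesis by (auto intro: pr_bind_le)
qed

text \<open>Points of mass at least \<open>t\<close> have total mass at most 1.\<close>

lemma finite_pmf_ge:
  assumes "0 < t"
  shows "finite {x. t \<le> pmf p x}" and "real (card {x. t \<le> pmf p x}) * t \<le> 1"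
proof -
  \<comment> \<open>Finite subsets come first: an infinite set has \<open>card\<close> 0, so its
    count would say nothing.\<close>
  have *: "real (card F) * t \<le> 1" if "finite F" "F \<subseteq> {x. t \<le> pmf p x}" for F
  proof -
    have "real (card F) * t \<le> (\<Sum>x\<in>F. pmf p x)"
      using that sum_mono[of F "\<lambda>_. t" "pmf p"] by auto
    also have "\<dots> = measure_pmf.prob p F" using that by (simp add: measure_measure_pmf_finite)
    also have "\<dots> \<le> 1" by simp
    finally show ?thesis .
  qed
  show "finite {x. t \<le> pmf p x}"
  proof (rule ccontr)
    assume inf: "infinite {x. t \<le> pmf p x}"
    obtain F where "finite F" "card F = nat \<lceil>1 / t\<rceil> + 1" "F \<subseteq> {x. t \<le> pmf p x}"
      using infinite_arbitrarily_large[OF inf] by blast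
    moreover have "1 / t < real (nat \<lceil>1 / t\<rceil> + 1)" by linarith
    ultimately show False using *[of F] assms by (simp add: field_simps)
  qed
  from *[OF this order_refl] show "real (card {x. t \<le> pmf p x}) * t \<le> 1" .
qed

text \<open>Side information comes first, the sources follow through kernels: the direct part tests
  \<open>pmf (K v) u\<close>, the converse freezes \<open>v1\<close>, \<open>v2\<close> and draws
  codebooks from the kernels.\<close>

definition paired_source ::
  "'v1 pmf \<Rightarrow> ('v1 \<Rightarrow> 'u1 pmf) \<Rightarrow> 'v2 pmf \<Rightarrow> ('v2 \<Rightarrow> 'u2 pmf) \<Rightarrow> ('u1 \<times> 'v1 \<times> 'u2 \<times> 'v2) pmf" where
  "paired_source V1 K1 V2 K2 = do {
     v1 \<leftarrow> V1; v2 \<leftarrow> V2; u1 \<leftarrow> K1 v1; u2 \<leftarrow> K2 v2; return_pmf (u1, v1, u2, v2)}"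

definition cond_source :: "'v pmf \<Rightarrow> ('v \<Rightarrow> 'u pmf) \<Rightarrow> ('u \<times> 'v) pmf" where
  "cond_source V K = do {v \<leftarrow> V; u \<leftarrow> K v; return_pmf (u, v)}"

lemma paired_source_marginal1:
  "map_pmf (\<lambda>(u1, v1, u2, v2). (u1, v1)) (paired_source V1 K1 V2 K2) = cond_source V1 K1"
  by (simp add: paired_source_def cond_source_def map_bind_pmf)

lemma paired_source_marginal2:
  "map_pmf (\<lambda>(u1, v1, u2, v2). (u2, v2)) (paired_source V1 K1 V2 K2) = cond_source V2 K2"
  by (simp add: paired_source_def cond_source_def map_bind_pmf)

lemma pr_paired_source1:
  "pr (paired_source V1 K1 V2 K2) (\<lambda>(u1, v1, u2, v2). A u1 v1) = pr (cond_source V1 K1) (\<lambda>(u, v). A u v)"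
  by (simp add: paired_source_marginal1[of V1 K1 V2 K2, symmetric] pr_map split_def)

lemma pr_paired_source2:
  "pr (paired_source V1 K1 V2 K2) (\<lambda>(u1, v1, u2, v2). A u2 v2) = pr (cond_source V2 K2) (\<lambda>(u, v). A u v)"
  by (simp add: paired_source_marginal2[of V1 K1 V2 K2, symmetric] pr_map split_def)

text \<open>
  The implication makes the choice fall back to an arbitrary element of \<open>A\<close> when there is no
  candidate: decoders must always return a word or a message.
\<close>

definition preimage_decoder :: "'a set \<Rightarrow> ('a \<Rightarrow> bool) \<Rightarrow> ('a \<Rightarrow> 'b) \<Rightarrow> 'b \<Rightarrow> 'a" where
  "preimage_decoder A T f y = (SOME x. x \<in> A \<and> ((\<exists>x'\<in>A. T x' \<and> f x' = y) \<longrightarrow> T x \<and> f x = y))"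

lemma preimage_decoder_in:
  assumes "A \<noteq> {}"
  shows "preimage_decoder A T f y \<in> A"
proof -
  have "\<exists>x. x \<in> A \<and> ((\<exists>x'\<in>A. T x' \<and> f x' = y) \<longrightarrow> T x \<and> f x = y)"
    using assms by blast
  from someI_ex[OF this] show ?thesis by (simp add: preimage_decoder_def)
qed

lemma preimage_decoder_eq:
  assumes "x \<in> A" "T x" "\<not> (\<exists>x'\<in>A - {x}. T x' \<and> f x' = f x)"
  shows "preimage_decoder A T f (f x) = x"
  unfolding preimage_decoder_def by (rule some_equality) (use assms in blast)+

text \<open>At most \<open>1 / t\<close> competitors have mass at least \<open>t\<close>, and each
  shares the bin of \<open>x\<close> with probability \<open>1 / card M\<close>.\<close>

lemma pr_bin_collision_le:
  assumes "finite A" "x \<in> A" "finite M" "M \<noteq> {}" "0 < t"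
  shows "pr (Pi_pmf A d (\<lambda>_. pmf_of_set M)) (\<lambda>b. \<exists>x'\<in>A - {x}. t \<le> pmf q x' \<and> b x' = b x)
           \<le> 1 / (t * card M)"
proof -
  let ?I = "{x' \<in> A - {x}. t \<le> pmf q x'}"
  have "pr (Pi_pmf A d (\<lambda>_. pmf_of_set M)) (\<lambda>b. \<exists>x'\<in>A - {x}. t \<le> pmf q x' \<and> b x' = b x)
      \<le> pr (Pi_pmf A d (\<lambda>_. pmf_of_set M)) (\<lambda>b. \<exists>x'\<in>?I. b x' = b x)"
    by (intro pr_mono) auto
  also have "\<dots> \<le> (\<Sum>x'\<in>?I. pr (Pi_pmf A d (\<lambda>_. pmf_of_set M)) (\<lambda>b. b x' = b x))"
    using assms by (intro pr_Bex_le) auto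
  also have "\<dots> \<le> (\<Sum>x'\<in>?I. 1 / card M)"
  proof (intro sum_mono)
    fix x' assume "x' \<in> ?I"
    then show "pr (Pi_pmf A d (\<lambda>_. pmf_of_set M)) (\<lambda>b. b x' = b x) \<le> 1 / card M"
      using pr_Pi_pmf_collision_le[of A x x' "\<lambda>_. True" "pmf_of_set M" "1 / card M" d] assms
      by (auto simp: indicator_def divide_right_mono)
  qed
  also have "\<dots> = real (card ?I) / card M" by simp
  also have "\<dots> \<le> real (card {x'. t \<le> pmf q x'}) / card M"
    using finite_pmf_ge(1)[OF \<open>0 < t\<close>, of q]
    by (intro divide_right_mono of_nat_mono card_mono) auto
  also have "\<dots> \<le> (1 / t) / card M"
    using finite_pmf_ge(2)[OF \<open>0 < t\<close>, of q] \<open>0 < t\<close>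
    by (intro divide_right_mono) (auto simp: field_simps)
  finally show ?thesis by simp
qed

text \<open>The likelihood bound sits on the codeword \<open>c m\<close> itself, so each other
  message repeats it with probability at most \<open>t\<close>. Not counting \<open>m\<close> makes
  the bound vanish for a single message, which rate 0 relies on.\<close>

lemma pr_codebook_collision_le:
  assumes "finite M" "m \<in> M" "0 \<le> t"
  shows "pr (Pi_pmf M d (\<lambda>_. q)) (\<lambda>c. \<exists>m'\<in>M - {m}. c m' = c m \<and> pmf q (c m) \<le> t)
           \<le> (real (card M) - 1) * t"
proof -
  have "pr (Pi_pmf M d (\<lambda>_. q)) (\<lambda>c. \<exists>m'\<in>M - {m}. c m' = c m \<and> pmf q (c m) \<le> t)
      \<le> (\<Sum>m'\<in>M - {m}. pr (Pi_pmf M d (\<lambda>_. q)) (\<lambda>c. c m' = c m \<and> pmf q (c m) \<le> t))"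
    using assms by (intro pr_Bex_le) auto
  also have "\<dots> \<le> (\<Sum>m'\<in>M - {m}. t)"
    using assms by (intro sum_mono pr_Pi_pmf_collision_le) auto
  also have "\<dots> = (real (card M) - 1) * t"
    using assms card_gt_0_iff[of M] by (auto simp: card_Diff_singleton of_nat_diff Suc_leI)
  finally show ?thesis .
qed

text \<open>The heart of random coding: at fixed arguments, independent random functions yield fresh
  independent samples.\<close>

lemma Pi_pmf_pair_component:
  assumes "finite A1" "finite A2" "x1 \<in> A1" "x2 \<in> A2"
  shows "map_pmf (\<lambda>(f1, f2). (f1 x1, f2 x2)) (pair_pmf (Pi_pmf A1 d1 (\<lambda>_. p1)) (Pi_pmf A2 d2 (\<lambda>_. p2)))
    = pair_pmf p1 p2"
  using assms Pi_pmf_component[of A1 x1 d1 "\<lambda>_. p1"] Pi_pmf_component[of A2 x2 d2 "\<lambda>_. p2"]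
  by (simp add: map_pair)

text \<open>
  The next two lemmas have no blocklength: sources, channels and messages are arbitrary.
  \<open>C\<close> is the channel followed by the given decoders.
\<close>

lemma one_shot_binning:
  fixes C :: "'w1 \<Rightarrow> 'w2 \<Rightarrow> ('w1 \<times> 'w2) pmf"
    and V1 :: "'v1 pmf" and K1 :: "'v1 \<Rightarrow> 'u1 pmf" and V2 :: "'v2 pmf" and K2 :: "'v2 \<Rightarrow> 'u2 pmf"
  assumes M: "finite M1" "M1 \<noteq> {}" "finite M2" "M2 \<noteq> {}"
    and A: "finite A1" "finite A2"
    and K1: "\<And>v. v \<in> set_pmf V1 \<Longrightarrow> set_pmf (K1 v) \<subseteq> A1"
    and K2: "\<And>v. v \<in> set_pmf V2 \<Longrightarrow> set_pmf (K2 v) \<subseteq> A2"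
    and t: "0 < t1" "0 < t2"
  shows "\<exists>b1\<in>A1 \<rightarrow> M1. \<exists>b2\<in>A2 \<rightarrow> M2.
    pr (do {(u1, v1, u2, v2) \<leftarrow> paired_source V1 K1 V2 K2; w \<leftarrow> C (b1 u1) (b2 u2);
            return_pmf ((u1, v1, u2, v2), w)})
       (\<lambda>((u1, v1, u2, v2), (w1, w2)). (u1, u2) \<noteq>
            (preimage_decoder A1 (\<lambda>u. t1 \<le> pmf (K1 v1) u) b1 w1,
             preimage_decoder A2 (\<lambda>u. t2 \<le> pmf (K2 v2) u) b2 w2))
    \<le> pr (do {m \<leftarrow> pair_pmf (pmf_of_set M1) (pmf_of_set M2); w \<leftarrow> C (fst m) (snd m); return_pmf (w, m)})
         (\<lambda>(w, m). w \<noteq> m)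
      + (pr (cond_source V1 K1) (\<lambda>(u, v). pmf (K1 v) u < t1) + 1 / (t1 * card M1))
      + (pr (cond_source V2 K2) (\<lambda>(u, v). pmf (K2 v) u < t2) + 1 / (t2 * card M2))"
    (is "\<exists>b1\<in>_. \<exists>b2\<in>_. ?err b1 b2 \<le> ?ch + (?a1 + ?c1) + (?a2 + ?c2)")
proof -
  define S where "S = paired_source V1 K1 V2 K2"
  define B1 where "B1 = Pi_pmf A1 undefined (\<lambda>_. pmf_of_set M1)"
  define B2 where "B2 = Pi_pmf A2 undefined (\<lambda>_. pmf_of_set M2)"
  define B where "B = pair_pmf B1 B2"
  define F where "F = (\<lambda>(u1, v1, u2, v2) (b1, b2). do {
      w \<leftarrow> C (b1 u1) (b2 u2); return_pmf ((u1 :: 'u1, v1 :: 'v1, u2 :: 'u2, v2 :: 'v2), b1, b2, w)})"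
  define D where "D = do {s \<leftarrow> S; b \<leftarrow> B; F s b}"
  define E where "E = (\<lambda>((u1, v1, u2, v2), b1, b2, (w1 :: 'w1, w2 :: 'w2)). (u1, u2) \<noteq>
            (preimage_decoder A1 (\<lambda>u. t1 \<le> pmf (K1 v1) u) b1 w1,
             preimage_decoder A2 (\<lambda>u. t2 \<le> pmf (K2 v2) u) b2 w2))"
  define Ech where "Ech = (\<lambda>((u1 :: 'u1, v1 :: 'v1, u2 :: 'u2, v2 :: 'v2), b1, b2, w). w \<noteq> (b1 u1 :: 'w1, b2 u2 :: 'w2))"
  define Et1 where "Et1 = (\<lambda>((u1, v1, u2 :: 'u2, v2 :: 'v2), b1 :: 'u1 \<Rightarrow> 'w1, b2 :: 'u2 \<Rightarrow> 'w2, w :: 'w1 \<times> 'w2). pmf (K1 v1) u1 < t1)"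
  define Et2 where "Et2 = (\<lambda>((u1 :: 'u1, v1 :: 'v1, u2, v2), b1 :: 'u1 \<Rightarrow> 'w1, b2 :: 'u2 \<Rightarrow> 'w2, w :: 'w1 \<times> 'w2). pmf (K2 v2) u2 < t2)"
  define Ec1 where "Ec1 = (\<lambda>((u1, v1, u2 :: 'u2, v2 :: 'v2), b1 :: 'u1 \<Rightarrow> 'w1, b2 :: 'u2 \<Rightarrow> 'w2, w :: 'w1 \<times> 'w2).
      \<exists>u\<in>A1 - {u1}. t1 \<le> pmf (K1 v1) u \<and> b1 u = b1 u1)"
  define Ec2 where "Ec2 = (\<lambda>((u1 :: 'u1, v1 :: 'v1, u2, v2), b1 :: 'u1 \<Rightarrow> 'w1, b2 :: 'u2 \<Rightarrow> 'w2, w :: 'w1 \<times> 'w2).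
      \<exists>u\<in>A2 - {u2}. t2 \<le> pmf (K2 v2) u \<and> b2 u = b2 u2)"
  note defs = Ech_def Et1_def Et2_def Ec1_def Ec2_def

  have S_A: "u1 \<in> A1 \<and> u2 \<in> A2" if "(u1, v1, u2, v2) \<in> set_pmf S" for u1 v1 u2 v2
    using that K1 K2 by (fastforce simp: S_def paired_source_def)

  \<comment> \<open>Without these events the channel code delivers the right bins, and the true
    words are the only likely words in them.\<close>
  have "pr D E \<le> pr D (\<lambda>x. Ech x \<or> (Et1 x \<or> Ec1 x) \<or> (Et2 x \<or> Ec2 x))"
  proof (rule pr_mono)
    fix x assume "x \<in> set_pmf D" "E x"
    then obtain u1 v1 u2 v2 b1 b2 w1 w2 where x: "x = ((u1, v1, u2, v2), b1, b2, (w1, w2))"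
      and s: "(u1, v1, u2, v2) \<in> set_pmf S"
      by (auto simp: D_def F_def)
    show "Ech x \<or> (Et1 x \<or> Ec1 x) \<or> (Et2 x \<or> Ec2 x)"
    proof (rule ccontr)
      assume "\<not> ?thesis"
      then have "preimage_decoder A1 (\<lambda>u. t1 \<le> pmf (K1 v1) u) b1 w1 = u1"
        "preimage_decoder A2 (\<lambda>u. t2 \<le> pmf (K2 v2) u) b2 w2 = u2"
        using S_A[OF s] preimage_decoder_eq[of u1 A1 "\<lambda>u. t1 \<le> pmf (K1 v1) u" b1]
          preimage_decoder_eq[of u2 A2 "\<lambda>u. t2 \<le> pmf (K2 v2) u" b2]
        by (auto simp: defs x not_less)
      then show False using \<open>E x\<close> by (simp add: E_def x)
    qed
  qed
  also have "\<dots> \<le> pr D Ech + ((pr D Et1 + pr D Ec1) + (pr D Et2 + pr D Ec2))"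
    by (intro order.trans[OF pr_disj_le] add_mono order_refl)
  \<comment> \<open>For fixed source words the pair of their bins is uniform, just like a random
    message pair, so the average error of the channel code appears.\<close>
  also have "pr D Ech \<le> ?ch"
    unfolding D_def
  proof (rule pr_bind_le)
    fix s assume "s \<in> set_pmf S"
    then obtain u1 v1 u2 v2 where s: "s = (u1, v1, u2, v2)" "u1 \<in> A1" "u2 \<in> A2"
      using S_A by (cases s) auto
    have "map_pmf Ech (B \<bind> F s) = map_pmf (\<lambda>(w, m). w \<noteq> m)
        (do {m \<leftarrow> map_pmf (\<lambda>(b1, b2). (b1 u1, b2 u2)) B; w \<leftarrow> C (fst m) (snd m); return_pmf (w, m)})"
      by (auto simp: s F_def Ech_def map_bind_pmf bind_map_pmf split_def intro!: bind_pmf_cong)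
    also have "map_pmf (\<lambda>(b1, b2). (b1 u1, b2 u2)) B = pair_pmf (pmf_of_set M1) (pmf_of_set M2)"
      unfolding B_def B1_def B2_def using A s by (intro Pi_pmf_pair_component)
    finally show "pr (B \<bind> F s) Ech \<le> ?ch" by (simp add: pr_def)
  qed
  also have "pr D Et1 = ?a1"
    unfolding pr_paired_source1[of V1 K1 V2 K2, symmetric] S_def[symmetric]
    by (simp add: D_def F_def Et1_def pr_def map_bind_pmf split_def) (simp add: map_pmf_def)
  also have "pr D Et2 = ?a2"
    unfolding pr_paired_source2[of V1 K1 V2 K2, symmetric] S_def[symmetric]
    by (simp add: D_def F_def Et2_def pr_def map_bind_pmf split_def) (simp add: map_pmf_def)
  also have "pr D Ec1 \<le> ?c1"
    unfolding D_def
  proof (rule pr_bind_le)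
    fix s assume "s \<in> set_pmf S"
    then obtain u1 v1 u2 v2 where s: "s = (u1, v1, u2, v2)" "u1 \<in> A1" "u2 \<in> A2"
      using S_A by (cases s) auto
    \<comment> \<open>Summing out the channel output and \<open>b2\<close> leaves the law of
      \<open>b1\<close>.\<close>
    have "pr (B \<bind> F s) Ec1 = pr (map_pmf fst B) (\<lambda>b. \<exists>u\<in>A1 - {u1}. t1 \<le> pmf (K1 v1) u \<and> b u = b u1)"
      unfolding pr_map by (simp add: s F_def Ec1_def pr_def map_bind_pmf split_def) (simp add: map_pmf_def)
    also have "\<dots> \<le> ?c1"
      unfolding B_def map_fst_pair_pmf B1_def using s A M t by (intro pr_bin_collision_le)
    finally show "pr (B \<bind> F s) Ec1 \<le> ?c1" .
  qed
  also have "pr D Ec2 \<le> ?c2"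
    unfolding D_def
  proof (rule pr_bind_le)
    fix s assume "s \<in> set_pmf S"
    then obtain u1 v1 u2 v2 where s: "s = (u1, v1, u2, v2)" "u1 \<in> A1" "u2 \<in> A2"
      using S_A by (cases s) auto
    have "pr (B \<bind> F s) Ec2 = pr (map_pmf snd B) (\<lambda>b. \<exists>u\<in>A2 - {u2}. t2 \<le> pmf (K2 v2) u \<and> b u = b u2)"
      unfolding pr_map by (simp add: s F_def Ec2_def pr_def map_bind_pmf split_def) (simp add: map_pmf_def)
    also have "\<dots> \<le> ?c2"
      unfolding B_def map_snd_pair_pmf B2_def using s A M t by (intro pr_bin_collision_le)
    finally show "pr (B \<bind> F s) Ec2 \<le> ?c2" .
  qed
  finally have le: "pr D E \<le> ?ch + (?a1 + ?c1) + (?a2 + ?c2)" by simp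
  \<comment> \<open>With the bins drawn first, one good pair of binnings can be fixed.\<close>
  have "D = do {b \<leftarrow> B; s \<leftarrow> S; F s b}"
    unfolding D_def by (rule bind_commute_pmf)
  then obtain b1 b2 where b: "(b1, b2) \<in> set_pmf B" "pr (do {s \<leftarrow> S; F s (b1, b2)}) E \<le> pr D E"
    using ex_pr_le_pr_bind[of B "\<lambda>b. S \<bind> (\<lambda>s. F s b)" E] by auto
  have err: "?err b1 b2 = pr (do {s \<leftarrow> S; F s (b1, b2)}) E"
    unfolding pr_def S_def by (simp add: F_def E_def map_bind_pmf split_def)
  have "b1 \<in> A1 \<rightarrow> M1" "b2 \<in> A2 \<rightarrow> M2"
    using b(1) A M by (auto simp: B_def B1_def B2_def set_Pi_pmf PiE_dflt_def)
  moreover have "?err b1 b2 \<le> ?ch + (?a1 + ?c1) + (?a2 + ?c2)"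
    unfolding err by (rule order.trans[OF b(2) le])
  ultimately show ?thesis by (intro bexI[of _ b1] bexI[of _ b2])
qed

lemma one_shot_codebook:
  fixes C :: "'v1 \<Rightarrow> 'v2 \<Rightarrow> 'u1 \<Rightarrow> 'u2 \<Rightarrow> ('u1 \<times> 'u2) pmf"
    and V1 :: "'v1 pmf" and K1 :: "'v1 \<Rightarrow> 'u1 pmf" and V2 :: "'v2 pmf" and K2 :: "'v2 \<Rightarrow> 'u2 pmf"
    and M1 :: "'m1 set" and M2 :: "'m2 set"
  assumes M: "finite M1" "M1 \<noteq> {}" "finite M2" "M2 \<noteq> {}"
    and t: "0 \<le> t1" "0 \<le> t2"
  shows "\<exists>v1\<in>set_pmf V1. \<exists>v2\<in>set_pmf V2. \<exists>c1\<in>M1 \<rightarrow> set_pmf (K1 v1). \<exists>c2\<in>M2 \<rightarrow> set_pmf (K2 v2).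
    pr (do {m \<leftarrow> pair_pmf (pmf_of_set M1) (pmf_of_set M2); w \<leftarrow> C v1 v2 (c1 (fst m)) (c2 (snd m)); return_pmf (m, w)})
       (\<lambda>(m, w). m \<noteq> (preimage_decoder M1 (\<lambda>_. True) c1 (fst w), preimage_decoder M2 (\<lambda>_. True) c2 (snd w)))
    \<le> pr (do {(u1, v1, u2, v2) \<leftarrow> paired_source V1 K1 V2 K2; w \<leftarrow> C v1 v2 u1 u2; return_pmf (u1, u2, w)})
         (\<lambda>(u1, u2, w). (u1, u2) \<noteq> w)
      + (pr (cond_source V1 K1) (\<lambda>(u, v). t1 < pmf (K1 v) u) + (real (card M1) - 1) * t1)
      + (pr (cond_source V2 K2) (\<lambda>(u, v). t2 < pmf (K2 v) u) + (real (card M2) - 1) * t2)"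
    (is "\<exists>v1\<in>_. \<exists>v2\<in>_. \<exists>c1\<in>_. \<exists>c2\<in>_. ?err v1 v2 c1 c2 \<le> ?src + (?a1 + ?c1) + (?a2 + ?c2)")
proof -
  define V where "V = pair_pmf V1 V2"
  define B where "B = (\<lambda>(v1, v2). pair_pmf (Pi_pmf M1 undefined (\<lambda>_. K1 v1)) (Pi_pmf M2 undefined (\<lambda>_. K2 v2)))"
  define m where "m = pair_pmf (pmf_of_set M1) (pmf_of_set M2)"
  define F where "F = (\<lambda>(v1 :: 'v1, v2 :: 'v2) (c1 :: 'm1 \<Rightarrow> 'u1, c2 :: 'm2 \<Rightarrow> 'u2) (m1, m2). do {
      w \<leftarrow> C v1 v2 (c1 m1) (c2 m2); return_pmf ((v1, v2), (c1, c2), (m1, m2), w)})"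
  \<comment> \<open>Messages precede codebooks here, so that codewords can be studied for fixed
    messages; the order is exchanged at the end.\<close>
  define D where "D = do {v \<leftarrow> V; m \<leftarrow> m; c \<leftarrow> B v; F v c m}"
  define E where "E = (\<lambda>((v1 :: 'v1, v2 :: 'v2), (c1 :: 'm1 \<Rightarrow> 'u1, c2 :: 'm2 \<Rightarrow> 'u2), m, w).
      m \<noteq> (preimage_decoder M1 (\<lambda>_. True) c1 (fst w), preimage_decoder M2 (\<lambda>_. True) c2 (snd w)))"
  define Esrc where "Esrc = (\<lambda>((v1 :: 'v1, v2 :: 'v2), (c1 :: 'm1 \<Rightarrow> 'u1, c2 :: 'm2 \<Rightarrow> 'u2), (m1, m2), w).
      (c1 m1, c2 m2) \<noteq> w)"
  define Et1 where "Et1 = (\<lambda>((v1, v2 :: 'v2), (c1, c2 :: 'm2 \<Rightarrow> 'u2), (m1 :: 'm1, m2 :: 'm2), w :: 'u1 \<times> 'u2).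
      t1 < pmf (K1 v1) (c1 m1))"
  define Et2 where "Et2 = (\<lambda>((v1 :: 'v1, v2), (c1 :: 'm1 \<Rightarrow> 'u1, c2), (m1 :: 'm1, m2 :: 'm2), w :: 'u1 \<times> 'u2).
      t2 < pmf (K2 v2) (c2 m2))"
  define Ec1 where "Ec1 = (\<lambda>((v1, v2 :: 'v2), (c1, c2 :: 'm2 \<Rightarrow> 'u2), (m1 :: 'm1, m2 :: 'm2), w :: 'u1 \<times> 'u2).
      \<exists>m\<in>M1 - {m1}. c1 m = c1 m1 \<and> pmf (K1 v1) (c1 m1) \<le> t1)"
  define Ec2 where "Ec2 = (\<lambda>((v1 :: 'v1, v2), (c1 :: 'm1 \<Rightarrow> 'u1, c2), (m1 :: 'm1, m2 :: 'm2), w :: 'u1 \<times> 'u2).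
      \<exists>m\<in>M2 - {m2}. c2 m = c2 m2 \<and> pmf (K2 v2) (c2 m2) \<le> t2)"
  note defs = Esrc_def Et1_def Et2_def Ec1_def Ec2_def

  have m_M: "m1 \<in> M1 \<and> m2 \<in> M2" if "(m1, m2) \<in> set_pmf m" for m1 m2
    using that M by (auto simp: m_def)
  have B_component: "map_pmf (\<lambda>(c1, c2). (c1 m1, c2 m2)) (B (v1, v2)) = pair_pmf (K1 v1) (K2 v2)"
    if "(m1, m2) \<in> set_pmf m" for m1 m2 v1 v2
    unfolding B_def prod.case using M m_M[OF that] by (intro Pi_pmf_pair_component) auto
  \<comment> \<open>An event that sees messages and codebooks only through the transmitted codewords
    has the same law as under the source: \<open>c1 m1\<close> and \<open>c2 m2\<close> are samples
    of \<open>K1 v1\<close> and \<open>K2 v2\<close> whatever the messages are.\<close>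
  have map_D: "map_pmf X D = do {
      (v1, v2) \<leftarrow> V; (u1, u2) \<leftarrow> pair_pmf (K1 v1) (K2 v2); w \<leftarrow> C v1 v2 u1 u2; return_pmf (Y v1 v2 u1 u2 w)}"
    if "\<And>v1 v2 c1 c2 m1 m2 w. X ((v1, v2), (c1, c2), (m1, m2), w) = Y v1 v2 (c1 m1) (c2 m2) w"
    for X and Y :: "'v1 \<Rightarrow> 'v2 \<Rightarrow> 'u1 \<Rightarrow> 'u2 \<Rightarrow> 'u1 \<times> 'u2 \<Rightarrow> bool"
  proof -
    have X: "X (v, c, m, w) = Y (fst v) (snd v) (fst c (fst m)) (snd c (snd m)) w" for v c m w
      using that by (cases v; cases c; cases m) simp
    have "map_pmf X D = do {(v1, v2) \<leftarrow> V; (m1, m2) \<leftarrow> m; (u1, u2) \<leftarrow> map_pmf (\<lambda>(c1, c2). (c1 m1, c2 m2)) (B (v1, v2));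
        w \<leftarrow> C v1 v2 u1 u2; return_pmf (Y v1 v2 u1 u2 w)}"
      by (simp add: D_def F_def map_bind_pmf bind_map_pmf split_def X)
    also have "\<dots> = do {(v1, v2) \<leftarrow> V; (m1, m2) \<leftarrow> m; (u1, u2) \<leftarrow> pair_pmf (K1 v1) (K2 v2);
        w \<leftarrow> C v1 v2 u1 u2; return_pmf (Y v1 v2 u1 u2 w)}"
      by (auto simp: B_component split_beta intro!: bind_pmf_cong)
    finally show ?thesis by (simp add: split_def)
  qed

  \<comment> \<open>If \<open>Esrc\<close> fails, \<open>w\<close> is the pair of transmitted
    codewords; if neither is repeated in its codebook, each has a single preimage.\<close>
  have "pr D E \<le> pr D (\<lambda>x. Esrc x \<or> (Et1 x \<or> Ec1 x) \<or> (Et2 x \<or> Ec2 x))"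
  proof (rule pr_mono)
    fix x assume "x \<in> set_pmf D" "E x"
    then obtain v1 v2 c1 c2 m1 m2 w where x: "x = ((v1, v2), (c1, c2), (m1, m2), w)"
      and s: "(m1, m2) \<in> set_pmf m"
      by (auto simp: D_def F_def)
    show "Esrc x \<or> (Et1 x \<or> Ec1 x) \<or> (Et2 x \<or> Ec2 x)"
    proof (rule ccontr)
      assume neg: "\<not> ?thesis"
      then have "preimage_decoder M1 (\<lambda>_. True) c1 (c1 m1) = m1"
        "preimage_decoder M2 (\<lambda>_. True) c2 (c2 m2) = m2"
        using m_M[OF s] by (auto simp: defs x not_less intro!: preimage_decoder_eq)
      then show False using \<open>E x\<close> neg by (auto simp: E_def Esrc_def x)
    qed
  qed
  also have "\<dots> \<le> pr D Esrc + ((pr D Et1 + pr D Ec1) + (pr D Et2 + pr D Ec2))"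
    by (intro order.trans[OF pr_disj_le] add_mono order_refl)
  also have "pr D Esrc = ?src"
    unfolding pr_def
    by (subst map_D[where Y = "\<lambda>v1 v2 u1 u2 w. (u1, u2) \<noteq> w"])
       (auto simp: Esrc_def V_def pair_pmf_def paired_source_def map_bind_pmf bind_assoc_pmf bind_return_pmf)
  also have "pr D Et1 = ?a1"
    unfolding pr_def
    by (subst map_D[where Y = "\<lambda>v1 v2 u1 u2 w. t1 < pmf (K1 v1) u1"])
       (auto simp: Et1_def V_def pair_pmf_def cond_source_def map_bind_pmf bind_assoc_pmf bind_return_pmf)
  also have "pr D Et2 = ?a2"
    unfolding pr_def
    by (subst map_D[where Y = "\<lambda>v1 v2 u1 u2 w. t2 < pmf (K2 v2) u2"])
       (auto simp: Et2_def V_def pair_pmf_def cond_source_def map_bind_pmf bind_assoc_pmf bind_return_pmf)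
  also have "pr D Ec1 \<le> ?c1"
    unfolding D_def
  proof (rule pr_bind_le, rule pr_bind_le)
    fix v :: "'v1 \<times> 'v2" and m' assume "m' \<in> set_pmf m"
    then obtain m1 m2 v1 v2 where s: "m' = (m1, m2)" "v = (v1, v2)" "m1 \<in> M1"
      using m_M by (cases m'; cases v) auto
    have "pr (B v \<bind> (\<lambda>c. F v c m')) Ec1
        = pr (map_pmf fst (B v)) (\<lambda>c. \<exists>m\<in>M1 - {m1}. c m = c m1 \<and> pmf (K1 v1) (c m1) \<le> t1)"
      unfolding pr_map by (simp add: s F_def Ec1_def pr_def map_bind_pmf split_def) (simp add: map_pmf_def)
    also have "\<dots> \<le> ?c1"
      unfolding B_def s(2) prod.case map_fst_pair_pmf using s M t by (intro pr_codebook_collision_le)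
    finally show "pr (B v \<bind> (\<lambda>c. F v c m')) Ec1 \<le> ?c1" .
  qed
  also have "pr D Ec2 \<le> ?c2"
    unfolding D_def
  proof (rule pr_bind_le, rule pr_bind_le)
    fix v :: "'v1 \<times> 'v2" and m' assume "m' \<in> set_pmf m"
    then obtain m1 m2 v1 v2 where s: "m' = (m1, m2)" "v = (v1, v2)" "m2 \<in> M2"
      using m_M by (cases m'; cases v) auto
    have "pr (B v \<bind> (\<lambda>c. F v c m')) Ec2
        = pr (map_pmf snd (B v)) (\<lambda>c. \<exists>m\<in>M2 - {m2}. c m = c m2 \<and> pmf (K2 v2) (c m2) \<le> t2)"
      unfolding pr_map by (simp add: s F_def Ec2_def pr_def map_bind_pmf split_def) (simp add: map_pmf_def)
    also have "\<dots> \<le> ?c2"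
      unfolding B_def s(2) prod.case map_snd_pair_pmf using s M t by (intro pr_codebook_collision_le)
    finally show "pr (B v \<bind> (\<lambda>c. F v c m')) Ec2 \<le> ?c2" .
  qed
  finally have le: "pr D E \<le> ?src + (?a1 + ?c1) + (?a2 + ?c2)" by simp
  \<comment> \<open>The codebook law depends on \<open>v\<close>, so \<open>v\<close> is fixed first
    and the codebooks second; the messages stay random, as in a channel code.\<close>
  have "D = do {v \<leftarrow> V; c \<leftarrow> B v; m \<leftarrow> m; F v c m}"
    unfolding D_def by (intro bind_pmf_cong refl bind_commute_pmf)
  then obtain v where v: "v \<in> set_pmf V" "pr (do {c \<leftarrow> B v; m \<leftarrow> m; F v c m}) E \<le> pr D E"
    using ex_pr_le_pr_bind[of V "\<lambda>v. do {c \<leftarrow> B v; m \<leftarrow> m; F v c m}" E] by auto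
  obtain c where c: "c \<in> set_pmf (B v)"
    "pr (do {m \<leftarrow> m; F v c m}) E \<le> pr (do {c \<leftarrow> B v; m \<leftarrow> m; F v c m}) E"
    using ex_pr_le_pr_bind[of "B v" "\<lambda>c. do {m \<leftarrow> m; F v c m}" E] by auto
  obtain v1 v2 c1 c2 where vc: "v = (v1, v2)" "c = (c1, c2)" by (cases v; cases c) auto
  have err: "?err v1 v2 c1 c2 = pr (do {m \<leftarrow> m; F v c m}) E"
    unfolding pr_def by (simp add: vc F_def E_def m_def map_bind_pmf split_def)
  have "v1 \<in> set_pmf V1" "v2 \<in> set_pmf V2" "c1 \<in> M1 \<rightarrow> set_pmf (K1 v1)" "c2 \<in> M2 \<rightarrow> set_pmf (K2 v2)"
    using v(1) c(1) M by (auto simp: vc V_def B_def set_Pi_pmf PiE_dflt_def)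
  moreover have "?err v1 v2 c1 c2 \<le> ?src + (?a1 + ?c1) + (?a2 + ?c2)"
    unfolding err by (rule order.trans[OF c(2) order.trans[OF v(2) le]])
  ultimately show ?thesis by (intro bexI[of _ v1] bexI[of _ v2] bexI[of _ c1] bexI[of _ c2])
qed

subsection \<open>Memoryless sources\<close>

text \<open>The law of \<open>U\<close> given \<open>V = v\<close>; unspecified if \<open>v\<close> has probability 0.\<close>

definition cond_law :: "('u \<times> 'v) pmf \<Rightarrow> 'v \<Rightarrow> 'u pmf" where
  "cond_law P v = map_pmf fst (cond_pmf P (snd -` {v}))"

lemma pmf_cond_law:
  assumes "v \<in> set_pmf (map_pmf snd P)"
  shows "pmf (cond_law P v) u = pmf P (u, v) / pmf (map_pmf snd P) v"
proof -
  have ne: "set_pmf P \<inter> snd -` {v} \<noteq> {}" using assms by auto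
  have "pmf (cond_law P v) u = measure_pmf.prob (cond_pmf P (snd -` {v})) (fst -` {u})"
    by (simp add: cond_law_def pmf_map)
  also have "\<dots> = measure_pmf.prob (cond_pmf P (snd -` {v})) {(u, v)}"
    by (intro measure_prob_cong_0) (auto simp: pmf_cond[OF ne])
  also have "\<dots> = pmf P (u, v) / pmf (map_pmf snd P) v"
    by (simp add: measure_pmf_single pmf_cond[OF ne] pmf_map)
  finally show ?thesis .
qed

text \<open>Disintegration, which puts an arbitrary joint law into the kernel form of the one-shot
  lemmas.\<close>

lemma cond_source_cond_law: "cond_source (map_pmf snd P) (cond_law P) = P"
proof (rule pmf_eqI)
  fix x :: "'a \<times> 'b"
  obtain u v where x: "x = (u, v)" by force
  have "pmf (cond_source (map_pmf snd P) (cond_law P)) x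
      = measure_pmf.expectation (map_pmf snd P) (\<lambda>v'. pmf (map_pmf (\<lambda>u. (u, v')) (cond_law P v')) (u, v))"
    unfolding cond_source_def pmf_bind x by (simp add: map_pmf_def pmf_bind)
  also have "\<dots> = measure_pmf.expectation (map_pmf snd P) (\<lambda>v'. pmf (cond_law P v) u * indicator {v} v')"
    by (intro Bochner_Integration.integral_cong refl)
       (auto simp: pmf_map vimage_def measure_pmf_single indicator_def)
  also have "\<dots> = pmf (cond_law P v) u * pmf (map_pmf snd P) v"
    by (simp add: measure_pmf_single)
  also have "\<dots> = pmf P (u, v)"
  proof (cases "v \<in> set_pmf (map_pmf snd P)")
    case True
    then show ?thesis by (simp add: pmf_cond_law pmf_eq_0_set_pmf)
  next
    \<comment> \<open>Here \<open>cond_law P v\<close> is unspecified, but its weight is 0, and so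
      is \<open>pmf P (u, v)\<close>.\<close>
    case False
    then have "(u, v) \<notin> set_pmf P" by force
    moreover have "pmf (map_pmf snd P) v = 0" using False by (simp only: set_pmf_iff not_not)
    ultimately show ?thesis by (simp add: set_pmf_iff)
  qed
  finally show "pmf (cond_source (map_pmf snd P) (cond_law P)) x = pmf P x" by (simp add: x)
qed

text \<open>The pairs are independent, so \<open>v2\<close> may be drawn before \<open>u1\<close>,
  as \<open>paired_source\<close> does.\<close>

lemma paired_source_cond_law:
  "paired_source (map_pmf snd P1) (cond_law P1) (map_pmf snd P2) (cond_law P2)
     = map_pmf (\<lambda>((u1, v1), (u2, v2)). (u1, v1, u2, v2)) (pair_pmf P1 P2)"
proof -
  have "map_pmf (\<lambda>((u1, v1), (u2, v2)). (u1, v1, u2, v2)) (pair_pmf P1 P2)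
    = map_pmf (\<lambda>((u1, v1), (u2, v2)). (u1, v1, u2, v2)) (pair_pmf
        (cond_source (map_pmf snd P1) (cond_law P1)) (cond_source (map_pmf snd P2) (cond_law P2)))"
    by (simp add: cond_source_cond_law)
  also have "\<dots> = do {v1 \<leftarrow> map_pmf snd P1; u1 \<leftarrow> cond_law P1 v1; v2 \<leftarrow> map_pmf snd P2; u2 \<leftarrow> cond_law P2 v2;
      return_pmf (u1, v1, u2, v2)}"
    by (simp add: pair_pmf_def cond_source_def bind_assoc_pmf bind_return_pmf map_bind_pmf del: bind_map_pmf)
  also have "\<dots> = paired_source (map_pmf snd P1) (cond_law P1) (map_pmf snd P2) (cond_law P2)"
    unfolding paired_source_def by (intro bind_pmf_cong refl bind_commute_pmf)
  finally show ?thesis by simp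
qed

section \<open>Source words as samples from kernels given side-information words\<close>

definition side_words :: "nat \<Rightarrow> ('u \<times> 'v) pmf \<Rightarrow> (nat \<Rightarrow> 'v) pmf" where
  "side_words n P = Pi_pmf {..<n} undefined (\<lambda>_. map_pmf snd P)"

text \<open>Given \<open>v\<close>, the source letters are independent, each with a law that depends
  on its own side-information letter.\<close>

definition cond_words :: "nat \<Rightarrow> ('u \<times> 'v) pmf \<Rightarrow> (nat \<Rightarrow> 'v) \<Rightarrow> (nat \<Rightarrow> 'u) pmf" where
  "cond_words n P v = Pi_pmf {..<n} undefined (\<lambda>i. cond_law P (v i))"

lemma set_Pi_pmf_words: "set_pmf (Pi_pmf {..<n} undefined p) \<subseteq> words n"
  by (auto simp: set_Pi_pmf PiE_dflt_def words_def PiE_def extensional_def)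

lemma set_cond_words: "set_pmf (cond_words n P v) \<subseteq> words n"
  and set_side_words: "set_pmf (side_words n P) \<subseteq> words n"
  unfolding cond_words_def side_words_def by (rule set_Pi_pmf_words)+

lemma finite_words: "finite (words n :: (nat \<Rightarrow> 'a :: finite) set)"
  by (auto simp: words_def intro: finite_PiE)

lemma words_not_empty: "words n \<noteq> {}"
  by (simp add: words_def PiE_eq_empty_iff)

text \<open>Beyond the block both sides are \<open>undefined\<close>, the right one because
  \<open>w\<close> is extensional.\<close>

lemma word_map_zip:
  assumes "w \<in> words n" "\<And>i. f (s i) = w i"
  shows "word_map n f (\<lambda>i. if i \<in> {..<n} then s i else undefined) = w"
  using assms by (auto simp: word_map_def words_def fun_eq_iff PiE_def extensional_def restrict_def)

text \<open>Products commute with staged sampling (\<open>Pi_pmf_bind\<close>), so \<open>n\<close>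
  letters form again a \<open>paired_source\<close>, now of words; hence the one-shot lemmas cover
  every blocklength.\<close>

lemma word_maps_paired_source:
  fixes P1 :: "('u1 \<times> 'v1) pmf" and P2 :: "('u2 \<times> 'v2) pmf"
  shows "map_pmf (\<lambda>s. (word_map n (\<lambda>((u1, v1), (u2, v2)). u1) s, word_map n (\<lambda>((u1, v1), (u2, v2)). v1) s,
             word_map n (\<lambda>((u1, v1), (u2, v2)). u2) s, word_map n (\<lambda>((u1, v1), (u2, v2)). v2) s))
           (Pi_pmf {..<n} undefined (\<lambda>_. pair_pmf P1 P2))
       = paired_source (side_words n P1) (cond_words n P1) (side_words n P2) (cond_words n P2)"
    (is "map_pmf ?f _ = _")
proof -
  have "pair_pmf P1 P2 = map_pmf (\<lambda>(u1, v1, u2, v2). ((u1, v1), (u2, v2)))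
      (paired_source (map_pmf snd P1) (cond_law P1) (map_pmf snd P2) (cond_law P2))"
    by (simp add: paired_source_cond_law pmf.map_comp o_def split_def)
  also have "\<dots> = do {v1 \<leftarrow> map_pmf snd P1; v2 \<leftarrow> map_pmf snd P2; u1 \<leftarrow> cond_law P1 v1; u2 \<leftarrow> cond_law P2 v2;
      return_pmf ((u1, v1), (u2, v2))}" (is "_ = ?pair")
    by (simp add: paired_source_def map_bind_pmf del: bind_map_pmf)
  finally have pair: "pair_pmf P1 P2 = ?pair" .
  have "Pi_pmf {..<n} undefined (\<lambda>_. pair_pmf P1 P2) = do {
      v1 \<leftarrow> side_words n P1; v2 \<leftarrow> side_words n P2; u1 \<leftarrow> cond_words n P1 v1; u2 \<leftarrow> cond_words n P2 v2;
      return_pmf (\<lambda>i. if i \<in> {..<n} then ((u1 i, v1 i), (u2 i, v2 i)) else undefined)}"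
    unfolding pair side_words_def cond_words_def
    by (subst Pi_pmf_bind[where d' = undefined], simp, rule bind_pmf_cong[OF refl])+
       (rule Pi_pmf_return_pmf, simp)
  then show ?thesis
    unfolding paired_source_def
    by (simp add: map_bind_pmf del: lessThan_iff)
       (intro bind_pmf_cong refl arg_cong[of _ _ return_pmf],
        auto intro!: word_map_zip dest: set_cond_words[THEN subsetD] set_side_words[THEN subsetD] simp del: lessThan_iff)
qed

text \<open>The same for one pair; it carries the weak law for i.i.d. samples over to
  \<open>cond_source\<close>.\<close>

lemma word_maps_cond_source:
  fixes P :: "('u \<times> 'v) pmf"
  shows "map_pmf (\<lambda>s. (word_map n fst s, word_map n snd s)) (Pi_pmf {..<n} undefined (\<lambda>_. P))
       = cond_source (side_words n P) (cond_words n P)"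
proof -
  have "Pi_pmf {..<n} undefined (\<lambda>_. P)
      = Pi_pmf {..<n} undefined (\<lambda>_. cond_source (map_pmf snd P) (cond_law P))"
    by (simp add: cond_source_cond_law)
  also have "\<dots> = do {v \<leftarrow> side_words n P; u \<leftarrow> cond_words n P v;
      return_pmf (\<lambda>i. if i \<in> {..<n} then (u i, v i) else undefined)}"
    unfolding cond_source_def side_words_def cond_words_def
    by (subst Pi_pmf_bind[where d' = undefined], simp, rule bind_pmf_cong[OF refl])+
       (rule Pi_pmf_return_pmf, simp)
  finally show ?thesis
    unfolding cond_source_def
    by (simp add: map_bind_pmf del: lessThan_iff)
       (intro bind_pmf_cong refl arg_cong[of _ _ return_pmf],
        auto intro!: word_map_zip dest: set_cond_words[THEN subsetD] set_side_words[THEN subsetD] simp del: lessThan_iff)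
qed

lemma source_channel_error_eq:
  fixes P1 :: "('u1 \<times> 'v1) pmf" and P2 :: "('u2 \<times> 'v2) pmf"
  shows "source_channel_error W P1 P2 n f1 f2 g1 g2 = pmf (do {
    (u1, v1, u2, v2) \<leftarrow> paired_source (side_words n P1) (cond_words n P1) (side_words n P2) (cond_words n P2);
    y \<leftarrow> memoryless_uses W n (f1 u1) (f2 u2);
    return_pmf ((u1, u2) \<noteq> (g1 (word_map n fst y) v1, g2 (word_map n snd y) v2))}) True"
  unfolding word_maps_paired_source[symmetric] bind_map_pmf
  by (simp add: source_channel_error_def Let_def)

lemma pmf_cond_words:
  "pmf (cond_words n P (word_map n snd s)) (word_map n fst s)
     = (\<Prod>i<n. pmf (cond_law P (snd (s i))) (fst (s i)))"
  unfolding cond_words_def by (subst pmf_Pi') (auto simp: word_map_def)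

text \<open>Entropy as the mean of the information density, the form that the weak law
  needs.\<close>

lemma cond_entropy_eq_expectation:
  fixes P :: "('u::finite \<times> 'v::finite) pmf"
  shows "cond_entropy P = measure_pmf.expectation P (\<lambda>(u, v). - log 2 (pmf (cond_law P v) u))"
proof -
  have "measure_pmf.expectation P (\<lambda>(u, v). - log 2 (pmf (cond_law P v) u))
      = (\<Sum>x\<in>UNIV. (case x of (u, v) \<Rightarrow> - log 2 (pmf (cond_law P v) u)) * pmf P x)"
    by (intro integral_measure_pmf_real) auto
  also have "\<dots> = (\<Sum>(u, v)\<in>UNIV. - (pmf P (u, v) * log 2 (pmf P (u, v) / pmf (map_pmf snd P) v)))"
  proof (intro sum.cong refl, clarify)
    fix u v
    \<comment> \<open>On the support \<open>cond_law\<close> is the quotient on the right; off it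
      the factor \<open>pmf P (u, v)\<close> annihilates both sides.\<close>
    show "- log 2 (pmf (cond_law P v) u) * pmf P (u, v)
        = - (pmf P (u, v) * log 2 (pmf P (u, v) / pmf (map_pmf snd P) v))"
    proof (cases "(u, v) \<in> set_pmf P")
      case True
      then have "v \<in> set_pmf (map_pmf snd P)" by force
      then show ?thesis by (simp add: pmf_cond_law)
    qed (simp add: pmf_eq_0_set_pmf)
  qed
  finally show ?thesis by (simp add: cond_entropy_eq split_def sum_negf)
qed

lemma cond_entropy_nonneg:
  fixes P :: "('u::finite \<times> 'v::finite) pmf"
  shows "0 \<le> cond_entropy P"
  unfolding cond_entropy_eq_expectation
proof (intro integral_nonneg_AE AE_pmfI, clarify)
  fix u v assume "(u, v) \<in> set_pmf P"
  then have "v \<in> set_pmf (map_pmf snd P)" by force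
  then have "0 < pmf (cond_law P v) u"
    using \<open>(u, v) \<in> set_pmf P\<close>
    by (simp add: pmf_cond_law pmf_positive del: set_map_pmf pmf.set_map)
  then show "0 \<le> - log 2 (pmf (cond_law P v) u)" by (simp add: pmf_le_1)
qed

subsection \<open>Asymptotic equipartition\<close>

lemma tendsto_0_squeeze:
  fixes f g :: "nat \<Rightarrow> real"
  assumes "\<And>n. 0 \<le> f n" "\<And>n. f n \<le> g n" "g \<longlonglongrightarrow> 0"
  shows "f \<longlonglongrightarrow> 0"
  by (rule tendsto_sandwich[OF always_eventually always_eventually tendsto_const assms(3)])
     (use assms in auto)

text \<open>By Hoeffding's inequality: \<open>X\<close> is bounded on a finite alphabet, so
  deviations of order \<open>n\<close> are exponentially unlikely.\<close>

lemma weak_law_Pi_pmf: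
  fixes P :: "'a::finite pmf" and X :: "'a \<Rightarrow> real"
  assumes "0 < \<epsilon>"
  shows "(\<lambda>n. pr (Pi_pmf {..<n} d (\<lambda>_. P))
            (\<lambda>s. real n * \<epsilon> \<le> \<bar>(\<Sum>i<n. X (s i)) - real n * measure_pmf.expectation P X\<bar>)) \<longlonglongrightarrow> 0"
proof -
  \<comment> \<open>The summand 1 keeps the interval length positive even for
    \<open>X = 0\<close>.\<close>
  define c where "c = (\<Sum>a\<in>UNIV. \<bar>X a\<bar>) + 1"
  have X: "X a \<in> {-c..c}" for a
  proof -
    have "\<bar>X a\<bar> \<le> (\<Sum>a\<in>UNIV. \<bar>X a\<bar>)" by (rule member_le_sum) auto
    then show ?thesis by (auto simp: c_def abs_le_iff)
  qed
  have c: "0 < c" unfolding c_def by (intro add_nonneg_pos sum_nonneg) auto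
  \<comment> \<open>For \<open>n = 0\<close> the sum of squared interval lengths, the denominator in
    Hoeffding's exponent, would be 0.\<close>
  have bound: "pr (Pi_pmf {..<n} d (\<lambda>_. P))
            (\<lambda>s. real n * \<epsilon> \<le> \<bar>(\<Sum>i<n. X (s i)) - real n * measure_pmf.expectation P X\<bar>)
      \<le> 2 * exp (- (\<epsilon>\<^sup>2 / (2 * c\<^sup>2)) * n)" if "0 < n" for n :: nat
  proof -
    define Q where "Q = Pi_pmf {..<n} d (\<lambda>_. P)"
    have E: "measure_pmf.expectation Q (\<lambda>s. X (s i)) = measure_pmf.expectation P X" if "i < n" for i
    proof -
      have "measure_pmf.expectation Q (\<lambda>s. X (s i)) = measure_pmf.expectation (map_pmf (\<lambda>s. s i) Q) X"
        by simp
      also have "map_pmf (\<lambda>s. s i) Q = P"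
        unfolding Q_def using that by (subst Pi_pmf_component) auto
      finally show ?thesis .
    qed
    interpret Hoeffding_ineq "measure_pmf Q" "{..<n}" "\<lambda>i s. X (s i)" "\<lambda>_. -c" "\<lambda>_. c"
      "\<Sum>i<n. measure_pmf.expectation Q (\<lambda>s. X (s i))"
    proof unfold_locales
      show "prob_space.indep_vars (measure_pmf Q) (\<lambda>_. borel) (\<lambda>i s. X (s i)) {..<n}"
        unfolding Q_def
        by (rule prob_space.indep_vars_compose2[OF measure_pmf.prob_space_axioms indep_vars_Pi_pmf]) auto
    qed (use X in auto)
    have sq: "(\<Sum>i<n. (c - - c)\<^sup>2) = real n * (4 * c\<^sup>2)" by (simp add: power2_eq_square)
    have "measure_pmf.prob Q {s \<in> space (measure_pmf Q). real n * \<epsilon> \<le> \<bar>(\<Sum>i<n. X (s i)) - (\<Sum>i<n. measure_pmf.expectation Q (\<lambda>s. X (s i)))\<bar>}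
        \<le> 2 * exp (- 2 * (real n * \<epsilon>)\<^sup>2 / (\<Sum>i<n. (c - - c)\<^sup>2))"
      using assms that c by (intro Hoeffding_ineq_abs_ge) (simp_all add: sq)
    also have "- 2 * (real n * \<epsilon>)\<^sup>2 / (\<Sum>i<n. (c - - c)\<^sup>2) = - (\<epsilon>\<^sup>2 / (2 * c\<^sup>2)) * real n"
      unfolding sq using that c by (simp add: field_simps power2_eq_square)
    finally show ?thesis by (simp add: pr_eq_prob E flip: Q_def)
  qed
  have lim: "(\<lambda>n. 2 * exp (- (\<epsilon>\<^sup>2 / (2 * c\<^sup>2)) * real n)) \<longlonglongrightarrow> 0"
  proof -
    have "(\<lambda>n. 2 * exp (- k * real n)) \<longlonglongrightarrow> 0" if "0 < k" for k :: real
      using that by real_asymp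
    from this[of "\<epsilon>\<^sup>2 / (2 * c\<^sup>2)"] show ?thesis using assms c by simp
  qed
  show ?thesis
  proof (rule tendsto_sandwich[OF _ _ tendsto_const lim])
    show "\<forall>\<^sub>F n in sequentially. pr (Pi_pmf {..<n} d (\<lambda>_. P))
            (\<lambda>s. real n * \<epsilon> \<le> \<bar>(\<Sum>i<n. X (s i)) - real n * measure_pmf.expectation P X\<bar>)
      \<le> 2 * exp (- (\<epsilon>\<^sup>2 / (2 * c\<^sup>2)) * n)"
      using eventually_gt_at_top[of 0] by eventually_elim (rule bound)
  qed (simp add: pr_nonneg)
qed

text \<open>Minus the logarithm of the conditional likelihood is a sum of i.i.d. information
  densities with mean \<open>cond_entropy P\<close>. Each one-sided event lies in a two-sided
  deviation of at least \<open>n * \<epsilon>\<close>.\<close>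

lemma asymptotic_equipartition:
  fixes P :: "('u::finite \<times> 'v::finite) pmf"
  assumes "0 < \<epsilon>"
  shows "(\<lambda>n. pr (cond_source (side_words n P) (cond_words n P))
            (\<lambda>(u, v). pmf (cond_words n P v) u < 2 powr (- (n * (cond_entropy P + \<epsilon>))))) \<longlonglongrightarrow> 0"
    and "(\<lambda>n. pr (cond_source (side_words n P) (cond_words n P))
            (\<lambda>(u, v). 2 powr (- (n * (cond_entropy P - \<epsilon>))) < pmf (cond_words n P v) u)) \<longlonglongrightarrow> 0"
proof -
  define X where "X = (\<lambda>(u, v). - log 2 (pmf (cond_law P v) u))"
  define D where "D = (\<lambda>n :: nat. Pi_pmf {..<n} (undefined :: 'u \<times> 'v) (\<lambda>_. P))"
  have H: "measure_pmf.expectation P X = cond_entropy P"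
    by (simp add: X_def cond_entropy_eq_expectation)
  have lim: "(\<lambda>n. pr (D n) (\<lambda>s. n * \<epsilon> \<le> \<bar>(\<Sum>i<n. X (s i)) - n * cond_entropy P\<bar>)) \<longlonglongrightarrow> 0"
    unfolding D_def H[symmetric] using assms by (rule weak_law_Pi_pmf)
  \<comment> \<open>On the support the likelihoods are positive, so \<open>2 powr\<close> inverts
    \<open>log 2\<close>.\<close>
  have eq: "pmf (cond_words n P (word_map n snd s)) (word_map n fst s) = 2 powr (- (\<Sum>i<n. X (s i)))"
    if "s \<in> set_pmf (D n)" for n :: nat and s
  proof -
    have "pmf (cond_law P (snd (s i))) (fst (s i)) = 2 powr (- X (s i))" if "i < n" for i
    proof -
      have si: "s i \<in> set_pmf P"
        using \<open>s \<in> set_pmf (D n)\<close> \<open>i < n\<close> by (auto simp: D_def set_Pi_pmf PiE_dflt_def)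
      then have "snd (s i) \<in> set_pmf (map_pmf snd P)" by force
      then have "0 < pmf (cond_law P (snd (s i))) (fst (s i))"
        using si by (simp add: pmf_cond_law pmf_positive del: set_map_pmf pmf.set_map)
      then show ?thesis by (simp add: X_def split_def)
    qed
    then show ?thesis by (simp add: pmf_cond_words powr_sum flip: sum_negf)
  qed
  have cond: "pr (cond_source (side_words n P) (cond_words n P)) A
      = pr (D n) (\<lambda>s. A (word_map n fst s, word_map n snd s))" for n A
    unfolding D_def word_maps_cond_source[symmetric] pr_map ..
  show "(\<lambda>n. pr (cond_source (side_words n P) (cond_words n P))
            (\<lambda>(u, v). pmf (cond_words n P v) u < 2 powr (- (n * (cond_entropy P + \<epsilon>))))) \<longlonglongrightarrow> 0"
    by (rule tendsto_sandwich[OF _ _ tendsto_const lim])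
       (auto simp: pr_nonneg cond eq algebra_simps intro!: always_eventually pr_mono)
  show "(\<lambda>n. pr (cond_source (side_words n P) (cond_words n P))
            (\<lambda>(u, v). 2 powr (- (n * (cond_entropy P - \<epsilon>))) < pmf (cond_words n P v) u)) \<longlonglongrightarrow> 0"
    by (rule tendsto_sandwich[OF _ _ tendsto_const lim])
       (auto simp: pr_nonneg cond eq algebra_simps intro!: always_eventually pr_mono)
qed

subsection \<open>Conversion between channel codes and source-channel codes\<close>

lemma messages_eq: "messages n R = {1..nat \<lfloor>2 powr (real n * R)\<rfloor>}"
  by (auto simp: messages_def le_nat_floor) (metis le_nat_iff of_int_of_nat_eq le_floor_iff powr_ge_zero zero_le_floor)

lemma finite_messages: "finite (messages n R)"
  by (simp add: messages_eq)

lemma card_messages_le: "real (card (messages n R)) \<le> 2 powr (real n * R)"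
  by (simp add: messages_eq)

text \<open>Rounding down a number that is at least 1 loses less than half of it, and
  \<open>0 \<le> R\<close> ensures that range.\<close>

lemma card_messages_ge:
  assumes "0 \<le> R"
  shows "2 powr (real n * R) \<le> 2 * real (card (messages n R))"
proof -
  have "1 \<le> (2 :: real) powr (real n * R)" using assms by (simp add: ge_one_powr_ge_zero)
  then have "1 \<le> \<lfloor>2 powr (real n * R)\<rfloor>" by (simp only: one_le_floor)
  moreover from this have "real (card (messages n R)) = of_int \<lfloor>2 powr (real n * R)\<rfloor>"
    by (simp add: messages_eq)
  ultimately show ?thesis by linarith
qed

lemma messages_not_empty:
  assumes "0 \<le> R"
  shows "messages n R \<noteq> {}"
proof -
  have "1 \<le> (2 :: real) powr (real n * R)" using assms by (simp add: ge_one_powr_ge_zero)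
  then have "1 \<in> messages n R" by (simp add: messages_def)
  then show ?thesis by blast
qed

lemma card_messages_0: "card (messages n 0) = 1"
  by (simp add: messages_eq)

text \<open>Binning at a fixed blocklength: each transmitter sends the channel codeword of the bin
  of its source word.\<close>

lemma source_code_of_channel_code:
  fixes W :: "('x1, 'x2, 'y1, 'y2) interference_channel"
    and P1 :: "('u1::finite \<times> 'v1) pmf" and P2 :: "('u2::finite \<times> 'v2) pmf"
  assumes code: "channel_code n R1 R2 e1 e2 d1 d2" and R: "0 \<le> R1" "0 \<le> R2" and t: "0 < t1" "0 < t2"
  shows "\<exists>f1 f2 g1 g2. source_channel_code n f1 f2 g1 g2 \<and>
    source_channel_error W P1 P2 n f1 f2 g1 g2 \<le> channel_code_error W n R1 R2 e1 e2 d1 d2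
      + (pr (cond_source (side_words n P1) (cond_words n P1)) (\<lambda>(u, v). pmf (cond_words n P1 v) u < t1)
          + 1 / (t1 * card (messages n R1)))
      + (pr (cond_source (side_words n P2) (cond_words n P2)) (\<lambda>(u, v). pmf (cond_words n P2 v) u < t2)
          + 1 / (t2 * card (messages n R2)))"
proof -
  \<comment> \<open>The given code as a random map from message pairs to decoded message
    pairs.\<close>
  define C where "C = (\<lambda>w1 w2. map_pmf (\<lambda>y. (d1 (word_map n fst y), d2 (word_map n snd y)))
      (memoryless_uses W n (e1 w1) (e2 w2)))"
  from one_shot_binning[of "messages n R1" "messages n R2" "words n" "words n"
      "side_words n P1" "cond_words n P1" "side_words n P2" "cond_words n P2" t1 t2 C,
      OF finite_messages messages_not_empty[OF R(1)] finite_messages messages_not_empty[OF R(2)]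
      finite_words finite_words set_cond_words set_cond_words t]
  obtain b1 b2 where b: "b1 \<in> words n \<rightarrow> messages n R1" "b2 \<in> words n \<rightarrow> messages n R2"
    and le: "pr (do {(u1, v1, u2, v2) \<leftarrow> paired_source (side_words n P1) (cond_words n P1) (side_words n P2) (cond_words n P2);
            w \<leftarrow> C (b1 u1) (b2 u2); return_pmf ((u1, v1, u2, v2), w)})
       (\<lambda>((u1, v1, u2, v2), (w1, w2)). (u1, u2) \<noteq>
            (preimage_decoder (words n) (\<lambda>u. t1 \<le> pmf (cond_words n P1 v1) u) b1 w1,
             preimage_decoder (words n) (\<lambda>u. t2 \<le> pmf (cond_words n P2 v2) u) b2 w2))
      \<le> pr (do {m \<leftarrow> pair_pmf (pmf_of_set (messages n R1)) (pmf_of_set (messages n R2));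
                w \<leftarrow> C (fst m) (snd m); return_pmf (w, m)}) (\<lambda>(w, m). w \<noteq> m)
      + (pr (cond_source (side_words n P1) (cond_words n P1)) (\<lambda>(u, v). pmf (cond_words n P1 v) u < t1)
          + 1 / (t1 * card (messages n R1)))
      + (pr (cond_source (side_words n P2) (cond_words n P2)) (\<lambda>(u, v). pmf (cond_words n P2 v) u < t2)
          + 1 / (t2 * card (messages n R2)))"
      (is "?L \<le> ?C + _ + _")
    by (elim bexE) (rule that)
  \<comment> \<open>The channel decoder names a bin, in which the receiver seeks a word that is
    likely given its side information.\<close>
  define g1 where "g1 = (\<lambda>y v. preimage_decoder (words n) (\<lambda>u. t1 \<le> pmf (cond_words n P1 v) u) b1 (d1 y))"
  define g2 where "g2 = (\<lambda>y v. preimage_decoder (words n) (\<lambda>u. t2 \<le> pmf (cond_words n P2 v) u) b2 (d2 y))"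
  have L: "?L = source_channel_error W P1 P2 n (\<lambda>u. e1 (b1 u)) (\<lambda>u. e2 (b2 u)) g1 g2"
    unfolding source_channel_error_eq pr_def
    by (simp add: C_def g1_def g2_def map_bind_pmf bind_map_pmf split_def)
  have C: "?C = channel_code_error W n R1 R2 e1 e2 d1 d2"
    unfolding channel_code_error_def pr_def
    by (simp add: C_def pair_pmf_def map_bind_pmf bind_map_pmf bind_assoc_pmf bind_return_pmf split_def)
  have code': "source_channel_code n (\<lambda>u. e1 (b1 u)) (\<lambda>u. e2 (b2 u)) g1 g2"
    using b code
    by (auto simp: source_channel_code_def channel_code_def g1_def g2_def Pi_iff
        intro!: preimage_decoder_in words_not_empty)
  show ?thesis by (intro exI conjI, rule code', rule le[unfolded L C])
qed

text \<open>Random codebooks at a fixed blocklength: a message selects a source word, which the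
  source-channel code transmits.\<close>

lemma channel_code_of_source_code:
  fixes W :: "('x1, 'x2, 'y1, 'y2) interference_channel"
    and P1 :: "('u1 \<times> 'v1) pmf" and P2 :: "('u2 \<times> 'v2) pmf"
  assumes code: "source_channel_code n f1 f2 g1 g2" and R: "0 \<le> R1" "0 \<le> R2" and t: "0 \<le> t1" "0 \<le> t2"
  shows "\<exists>e1 e2 d1 d2. channel_code n R1 R2 e1 e2 d1 d2 \<and>
    channel_code_error W n R1 R2 e1 e2 d1 d2 \<le> source_channel_error W P1 P2 n f1 f2 g1 g2
      + (pr (cond_source (side_words n P1) (cond_words n P1)) (\<lambda>(u, v). t1 < pmf (cond_words n P1 v) u)
          + (real (card (messages n R1)) - 1) * t1)
      + (pr (cond_source (side_words n P2) (cond_words n P2)) (\<lambda>(u, v). t2 < pmf (cond_words n P2 v) u)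
          + (real (card (messages n R2)) - 1) * t2)"
proof -
  define C where "C = (\<lambda>v1 v2 u1 u2. map_pmf (\<lambda>y. (g1 (word_map n fst y) v1, g2 (word_map n snd y) v2))
      (memoryless_uses W n (f1 u1) (f2 u2)))"
  from one_shot_codebook[of "messages n R1" "messages n R2" t1 t2
      "side_words n P1" "side_words n P2" "cond_words n P1" "cond_words n P2" C,
      OF finite_messages messages_not_empty[OF R(1)] finite_messages messages_not_empty[OF R(2)] t]
  obtain v1 v2 c1 c2 where
    c: "c1 \<in> messages n R1 \<rightarrow> set_pmf (cond_words n P1 v1)" "c2 \<in> messages n R2 \<rightarrow> set_pmf (cond_words n P2 v2)"
    and le: "pr (do {m \<leftarrow> pair_pmf (pmf_of_set (messages n R1)) (pmf_of_set (messages n R2));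
         w \<leftarrow> C v1 v2 (c1 (fst m)) (c2 (snd m)); return_pmf (m, w)})
       (\<lambda>(m, w). m \<noteq> (preimage_decoder (messages n R1) (\<lambda>_. True) c1 (fst w),
                      preimage_decoder (messages n R2) (\<lambda>_. True) c2 (snd w)))
    \<le> pr (do {(u1, v1, u2, v2) \<leftarrow> paired_source (side_words n P1) (cond_words n P1) (side_words n P2) (cond_words n P2);
              w \<leftarrow> C v1 v2 u1 u2; return_pmf (u1, u2, w)})
         (\<lambda>(u1, u2, w). (u1, u2) \<noteq> w)
      + (pr (cond_source (side_words n P1) (cond_words n P1)) (\<lambda>(u, v). t1 < pmf (cond_words n P1 v) u)
          + (real (card (messages n R1)) - 1) * t1)
      + (pr (cond_source (side_words n P2) (cond_words n P2)) (\<lambda>(u, v). t2 < pmf (cond_words n P2 v) u)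
          + (real (card (messages n R2)) - 1) * t2)"
      (is "?L \<le> ?S + _ + _")
    by (elim bexE) (rule that)
  have c_words: "c1 \<in> messages n R1 \<rightarrow> words n" "c2 \<in> messages n R2 \<rightarrow> words n"
    using c set_cond_words[of n P1 v1] set_cond_words[of n P2 v2] by auto
  \<comment> \<open>\<open>v1\<close> and \<open>v2\<close> are constants by now, so the decoders
    use the channel output alone, as a channel code demands.\<close>
  define d1 where "d1 = (\<lambda>y. preimage_decoder (messages n R1) (\<lambda>_. True) c1 (g1 y v1))"
  define d2 where "d2 = (\<lambda>y. preimage_decoder (messages n R2) (\<lambda>_. True) c2 (g2 y v2))"
  have L: "?L = channel_code_error W n R1 R2 (\<lambda>m. f1 (c1 m)) (\<lambda>m. f2 (c2 m)) d1 d2"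
    unfolding channel_code_error_def pr_def
    by (simp add: C_def d1_def d2_def pair_pmf_def map_bind_pmf bind_map_pmf bind_assoc_pmf bind_return_pmf
        split_def eq_commute)
  have S: "?S = source_channel_error W P1 P2 n f1 f2 g1 g2"
    unfolding source_channel_error_eq pr_def
    by (simp add: C_def map_bind_pmf bind_map_pmf split_def)
  have code': "channel_code n R1 R2 (\<lambda>m. f1 (c1 m)) (\<lambda>m. f2 (c2 m)) d1 d2"
    using c_words code R
    by (auto simp: source_channel_code_def channel_code_def d1_def d2_def Pi_iff
        intro!: preimage_decoder_in messages_not_empty)
  show ?thesis by (intro exI conjI, rule code', rule le[unfolded L S])
qed

lemma source_channel_error_nonneg: "0 \<le> source_channel_error W P1 P2 n f1 f2 g1 g2"
  by (simp add: source_channel_error_def)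

lemma channel_code_error_nonneg: "0 \<le> channel_code_error W n R1 R2 e1 e2 d1 d2"
  by (simp add: channel_code_error_def)

section \<open>Decay of the atypicality and collision terms\<close>

lemma tendsto_2_powr_neg:
  assumes "0 < c"
  shows "(\<lambda>n. (2 :: real) powr (- (real n * c))) \<longlonglongrightarrow> 0"
  using assms by real_asymp

text \<open>The threshold exponent lies midway between entropy and rate. At most
  \<open>2 powr (n * (R - \<epsilon>))\<close> likely words meet at least
  \<open>2 powr (n * R) / 2\<close> bins, so the collision term is at most
  \<open>2 * 2 powr (- (n * \<epsilon>))\<close>.\<close>

lemma binning_bound_tendsto_0:
  fixes P :: "('u::finite \<times> 'v::finite) pmf"
  assumes "cond_entropy P < R" "\<epsilon> = (R - cond_entropy P) / 2"
  shows "(\<lambda>n. pr (cond_source (side_words n P) (cond_words n P))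
                (\<lambda>(u, v). pmf (cond_words n P v) u < 2 powr (- (n * (cond_entropy P + \<epsilon>))))
              + 1 / (2 powr (- (n * (cond_entropy P + \<epsilon>))) * card (messages n R))) \<longlonglongrightarrow> 0"
proof (intro tendsto_add_zero asymptotic_equipartition)
  show \<epsilon>: "0 < \<epsilon>" using assms by simp
  have R: "0 \<le> R" using assms(1) cond_entropy_nonneg[of P] by linarith
  have "1 / (2 powr (- (n * (cond_entropy P + \<epsilon>))) * card (messages n R)) \<le> 2 * 2 powr (- (n * \<epsilon>))" for n :: nat
  proof -
    have "2 powr (n * \<epsilon>) = 2 powr (- (n * (cond_entropy P + \<epsilon>))) * 2 powr (n * R)"
      unfolding powr_add[symmetric] assms(2) by (simp add: field_simps)
    also have "\<dots> \<le> 2 powr (- (n * (cond_entropy P + \<epsilon>))) * (2 * card (messages n R))"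
      using card_messages_ge[OF R] by (intro mult_left_mono) auto
    finally have "2 powr (n * \<epsilon>) / 2 \<le> 2 powr (- (n * (cond_entropy P + \<epsilon>))) * card (messages n R)" by simp
    then have "1 / (2 powr (- (n * (cond_entropy P + \<epsilon>))) * card (messages n R)) \<le> 1 / (2 powr (n * \<epsilon>) / 2)"
      using messages_not_empty[OF R, of n] finite_messages[of n R]
      by (intro divide_left_mono mult_pos_pos) (auto simp: card_gt_0_iff)
    then show ?thesis by (simp add: powr_minus field_simps)
  qed
  moreover have "(\<lambda>n. 2 * (2 :: real) powr (- (real n * \<epsilon>))) \<longlonglongrightarrow> 0"
    by (intro tendsto_mult_right_zero tendsto_2_powr_neg \<epsilon>)
  ultimately show "(\<lambda>n. 1 / (2 powr (- (n * (cond_entropy P + \<epsilon>))) * card (messages n R))) \<longlonglongrightarrow> 0"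
    by (rule tendsto_0_squeeze[rotated]) simp
qed

text \<open>At a positive rate the threshold exponent exceeds \<open>R\<close> by
  \<open>\<epsilon>\<close>, so collisions decay like \<open>2 powr (- (n * \<epsilon>))\<close>;
  \<open>max 0\<close> keeps the rate admissible for small entropy.\<close>

lemma codebook_bound_tendsto_0:
  fixes P :: "('u::finite \<times> 'v::finite) pmf"
  assumes "0 < \<epsilon>" and R: "R = max 0 (cond_entropy P - 2 * \<epsilon>)"
  shows "(\<lambda>n. pr (cond_source (side_words n P) (cond_words n P))
                (\<lambda>(u, v). 2 powr (- (n * (cond_entropy P - \<epsilon>))) < pmf (cond_words n P v) u)
              + (real (card (messages n R)) - 1) * 2 powr (- (n * (cond_entropy P - \<epsilon>)))) \<longlonglongrightarrow> 0"
proof (intro tendsto_add_zero asymptotic_equipartition assms(1))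
  have "0 \<le> (real (card (messages n R)) - 1) * 2 powr (- (n * (cond_entropy P - \<epsilon>)))" for n :: nat
    using card_gt_0_iff[of "messages n R"] finite_messages[of n R] messages_not_empty[of R n] R
    by (intro mult_nonneg_nonneg) auto
  moreover have "(real (card (messages n R)) - 1) * 2 powr (- (n * (cond_entropy P - \<epsilon>))) \<le> 2 powr (- (n * \<epsilon>))"
    for n :: nat
  proof (cases "cond_entropy P - 2 * \<epsilon> \<le> 0")
    \<comment> \<open>The threshold may even grow with \<open>n\<close> here, but at rate 0 there is
      one message and the factor \<open>card - 1\<close> is 0.\<close>
    case True
    then show ?thesis by (simp add: R card_messages_0)
  next
    case False
    have "(real (card (messages n R)) - 1) * 2 powr (- (n * (cond_entropy P - \<epsilon>)))
        \<le> 2 powr (n * R) * 2 powr (- (n * (cond_entropy P - \<epsilon>)))"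
      using card_messages_le[of n R] by (intro mult_right_mono) auto
    also have "\<dots> = 2 powr (- (n * \<epsilon>))"
      using False by (simp add: R algebra_simps flip: powr_add)
    finally show ?thesis .
  qed
  ultimately show "(\<lambda>n. (real (card (messages n R)) - 1) * 2 powr (- (n * (cond_entropy P - \<epsilon>)))) \<longlonglongrightarrow> 0"
    by (rule tendsto_0_squeeze[OF _ _ tendsto_2_powr_neg[OF assms(1)]])
qed

section \<open>From single blocklengths to sequences of codes\<close>

lemma reliably_transmittable_if_achievable:
  fixes W :: "('x1, 'x2, 'y1, 'y2) interference_channel"
    and P1 :: "('u1::finite \<times> 'v1::finite) pmf" and P2 :: "('u2::finite \<times> 'v2::finite) pmf"
  assumes ach: "achievable W (R1, R2)" and R: "cond_entropy P1 < R1" "cond_entropy P2 < R2"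
  shows "reliably_transmittable W P1 P2"
proof -
  obtain e1 e2 d1 d2 where code: "\<And>n. channel_code n R1 R2 (e1 n) (e2 n) (d1 n) (d2 n)"
    and err: "(\<lambda>n. channel_code_error W n R1 R2 (e1 n) (e2 n) (d1 n) (d2 n)) \<longlonglongrightarrow> 0"
    and R0: "0 \<le> R1" "0 \<le> R2"
    using ach by (auto simp: achievable_def)
  \<comment> \<open>Exponents midway between entropy and rate, as in
    \<open>binning_bound_tendsto_0\<close>; \<open>b\<close> collects the error bounds at
    blocklength \<open>n\<close>.\<close>
  define t1 where "t1 = (\<lambda>n :: nat. 2 powr (- (n * (cond_entropy P1 + (R1 - cond_entropy P1) / 2))))"
  define t2 where "t2 = (\<lambda>n :: nat. 2 powr (- (n * (cond_entropy P2 + (R2 - cond_entropy P2) / 2))))"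
  define b where "b = (\<lambda>n. channel_code_error W n R1 R2 (e1 n) (e2 n) (d1 n) (d2 n)
      + (pr (cond_source (side_words n P1) (cond_words n P1)) (\<lambda>(u, v). pmf (cond_words n P1 v) u < t1 n)
          + 1 / (t1 n * card (messages n R1)))
      + (pr (cond_source (side_words n P2) (cond_words n P2)) (\<lambda>(u, v). pmf (cond_words n P2 v) u < t2 n)
          + 1 / (t2 n * card (messages n R2))))"
  have b: "b \<longlonglongrightarrow> 0"
    unfolding b_def t1_def t2_def
    by (intro tendsto_add_zero[OF tendsto_add_zero] err binning_bound_tendsto_0 R refl)
  have "\<forall>n. \<exists>f1 f2 g1 g2. source_channel_code n f1 f2 g1 g2 \<and> source_channel_error W P1 P2 n f1 f2 g1 g2 \<le> b n"
    unfolding b_def by (intro allI source_code_of_channel_code code R0) (simp_all add: t1_def t2_def)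
  then obtain f1 f2 g1 g2 where "\<And>n. source_channel_code n (f1 n) (f2 n) (g1 n) (g2 n)"
    and le: "\<And>n. source_channel_error W P1 P2 n (f1 n) (f2 n) (g1 n) (g2 n) \<le> b n"
    by metis
  moreover have "(\<lambda>n. source_channel_error W P1 P2 n (f1 n) (f2 n) (g1 n) (g2 n)) \<longlonglongrightarrow> 0"
    by (rule tendsto_0_squeeze[OF _ le b]) (rule source_channel_error_nonneg)
  ultimately show ?thesis unfolding reliably_transmittable_def by blast
qed

lemma achievable_if_reliably_transmittable:
  fixes W :: "('x1, 'x2, 'y1, 'y2) interference_channel"
    and P1 :: "('u1::finite \<times> 'v1::finite) pmf" and P2 :: "('u2::finite \<times> 'v2::finite) pmf"
  assumes "reliably_transmittable W P1 P2" and \<epsilon>: "0 < \<epsilon>"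
  shows "achievable W (max 0 (cond_entropy P1 - 2 * \<epsilon>), max 0 (cond_entropy P2 - 2 * \<epsilon>))"
    (is "achievable W (?R1, ?R2)")
proof -
  obtain f1 f2 g1 g2 where code: "\<And>n. source_channel_code n (f1 n) (f2 n) (g1 n) (g2 n)"
    and err: "(\<lambda>n. source_channel_error W P1 P2 n (f1 n) (f2 n) (g1 n) (g2 n)) \<longlonglongrightarrow> 0"
    using assms by (auto simp: reliably_transmittable_def)
  \<comment> \<open>The exponent lies \<open>\<epsilon>\<close> below the entropy, and a positive
    rate \<open>2 * \<epsilon>\<close> below it, as in
    \<open>codebook_bound_tendsto_0\<close>.\<close>
  define t1 where "t1 = (\<lambda>n :: nat. 2 powr (- (n * (cond_entropy P1 - \<epsilon>))))"
  define t2 where "t2 = (\<lambda>n :: nat. 2 powr (- (n * (cond_entropy P2 - \<epsilon>))))"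
  define b where "b = (\<lambda>n. source_channel_error W P1 P2 n (f1 n) (f2 n) (g1 n) (g2 n)
      + (pr (cond_source (side_words n P1) (cond_words n P1)) (\<lambda>(u, v). t1 n < pmf (cond_words n P1 v) u)
          + (real (card (messages n ?R1)) - 1) * t1 n)
      + (pr (cond_source (side_words n P2) (cond_words n P2)) (\<lambda>(u, v). t2 n < pmf (cond_words n P2 v) u)
          + (real (card (messages n ?R2)) - 1) * t2 n))"
  have b: "b \<longlonglongrightarrow> 0"
    unfolding b_def t1_def t2_def
    by (intro tendsto_add_zero[OF tendsto_add_zero] err codebook_bound_tendsto_0 \<epsilon> refl)
  have "\<forall>n. \<exists>e1 e2 d1 d2. channel_code n ?R1 ?R2 e1 e2 d1 d2 \<and> channel_code_error W n ?R1 ?R2 e1 e2 d1 d2 \<le> b n"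
    unfolding b_def by (intro allI channel_code_of_source_code code) (simp_all add: t1_def t2_def)
  then obtain e1 e2 d1 d2 where "\<And>n. channel_code n ?R1 ?R2 (e1 n) (e2 n) (d1 n) (d2 n)"
    and le: "\<And>n. channel_code_error W n ?R1 ?R2 (e1 n) (e2 n) (d1 n) (d2 n) \<le> b n"
    by metis
  moreover have "(\<lambda>n. channel_code_error W n ?R1 ?R2 (e1 n) (e2 n) (d1 n) (d2 n)) \<longlonglongrightarrow> 0"
    by (rule tendsto_0_squeeze[OF _ le b]) (rule channel_code_error_nonneg)
  ultimately show ?thesis unfolding achievable_def by auto
qed

section \<open>Interior and closure of the capacity region\<close>

theorem theorem1:
  fixes W :: "('x1::finite, 'x2::finite, 'y1::finite, 'y2::finite) interference_channel"
    and P1 :: "('u1::finite \<times> 'v1::finite) pmf"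
    and P2 :: "('u2::finite \<times> 'v2::finite) pmf"
  shows "((cond_entropy P1, cond_entropy P2) \<in> interior (capacity_region W)
            \<longrightarrow> reliably_transmittable W P1 P2) \<and>
         ((cond_entropy P1, cond_entropy P2) \<notin> capacity_region W
            \<longrightarrow> \<not> reliably_transmittable W P1 P2)"
proof (intro conjI impI notI)
  let ?H1 = "cond_entropy P1" and ?H2 = "cond_entropy P2"
  have dist_le: "dist (a, b) (c, d) \<le> \<bar>a - c\<bar> + \<bar>b - d\<bar>" for a b c d :: real
    by (simp add: dist_Pair_Pair dist_real_def sqrt_sum_squares_le_sum_abs)
  {
    assume "(?H1, ?H2) \<in> interior (capacity_region W)"
    then obtain e where e: "0 < e" "ball (?H1, ?H2) e \<subseteq> capacity_region W"
      by (auto simp: mem_interior)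
    \<comment> \<open>Raising both coordinates by \<open>e / 4\<close> moves the point by at most
      \<open>e / 2\<close>, so it stays in the ball.\<close>
    have "(?H1 + e / 4, ?H2 + e / 4) \<in> ball (?H1, ?H2) e"
      using dist_le[of ?H1 ?H2 "?H1 + e / 4" "?H2 + e / 4"] e(1) by simp
    then have "(?H1 + e / 4, ?H2 + e / 4) \<in> closure {R. achievable W R}"
      using e(2) by (auto simp: capacity_region_def)
    moreover have "0 < e / 4" using e(1) by simp
    \<comment> \<open>An achievable pair closer than \<open>e / 4\<close> to the shifted point still
      exceeds both entropies strictly.\<close>
    ultimately obtain R1 R2 where ach: "achievable W (R1, R2)"
      and R: "dist (R1, R2) (?H1 + e / 4, ?H2 + e / 4) < e / 4"
      unfolding closure_approachable by fastforce
    have "?H1 < R1" "?H2 < R2"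
      using R dist_fst_le[of "(R1, R2)" "(?H1 + e / 4, ?H2 + e / 4)"]
        dist_snd_le[of "(R1, R2)" "(?H1 + e / 4, ?H2 + e / 4)"]
      by (auto simp: dist_real_def)
    with ach show "reliably_transmittable W P1 P2" by (rule reliably_transmittable_if_achievable)
  next
    assume notin: "(?H1, ?H2) \<notin> capacity_region W" and rel: "reliably_transmittable W P1 P2"
    have "(?H1, ?H2) \<in> closure {R. achievable W R}"
      unfolding closure_approachable
    proof (intro allI impI)
      fix e :: real assume e: "0 < e"
      \<comment> \<open>Each coordinate moves by at most \<open>e / 4\<close>, also when clipped at
        0 since entropies are nonnegative, so the distance stays below \<open>e\<close>.\<close>
      let ?R1 = "max 0 (?H1 - 2 * (e / 8))" and ?R2 = "max 0 (?H2 - 2 * (e / 8))"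
      have "achievable W (?R1, ?R2)"
        using rel e by (intro achievable_if_reliably_transmittable) auto
      moreover have "dist (?R1, ?R2) (?H1, ?H2) < e"
        using dist_le[of ?R1 ?R2 ?H1 ?H2] cond_entropy_nonneg[of P1] cond_entropy_nonneg[of P2] e
        by (auto simp: max_def abs_if split: if_splits)
      ultimately show "\<exists>R\<in>{R. achievable W R}. dist R (?H1, ?H2) < e" by blast
    qed
    then show False using notin by (simp add: capacity_region_def)
  }
qed

end
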